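(* Let $\lambda\in(0,1)$, $d\in(0,1-\lambda)$, $\rho\in(0,1)\setminus\mathbb{Q}$ and $\alpha\in[0,1]$. Let $\delta\in(1-\lambda-d,1)$ and $a\in[0,1]$ satisfy $\delta\in[\delta(\rho^-,\alpha),\delta(\rho,\alpha)]$ and $a\in[a(\delta,\rho^+,\alpha),a(\delta,\rho,\alpha)]$, and consider the map $f_{\delta,a}$. Let $\eta=\eta_1$ if $\alpha\in[0,1-\rho)$, $\eta=a$ if $\alpha=1-\rho$ and $\eta=\eta_2$ if $\alpha\in(1-\rho,1]$, and let $P$ be the partition of $[0,1)$ in two or three left closed intervals defined by the positions of $a$ and $\eta$ in $[0,1)$. Let $x\in\Lambda$ and let $p:\mathbb{N}\setminus\{0\}\to\mathbb{N}$ be the complexity function of the code of the orbit of $x$ under $f_{\delta,a}$ with respect to $P$. Then, 1. $P$ is the partition given by the positions of the discontinuities of $f_{\delta,a}$ in $[0,1)$. 2. If $\{\alpha\}\neq R_\rho^k(0)$ for every $k\in\mathbb{Z}$, we have $p(n)=2n+1$ for all $n\ge1$. 3. If $\{\alpha\}=R_\rho^k(0)$ for some $k\in\mathbb{Z}$, we have $p(n)=n+b$ for all $n\ge\max\{1,b-1\}$, where $b=|k|$ if $k\le-2$, $b=1$ if $k\in\{-1,0\}$ and $b=k+1$ if $k\ge1$.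
   Context: Notation: $\mathbb{N}=\{0,1,2,\dots\}$; $\lfloor x\rfloor$ is the integer part and $\{x\}=x-\lfloor x\rfloor$ the fractional part of $x\in\mathbb{R}$. For $c\in\mathbb{R}$, $\theta_c(z)=0$ if $z<c$ and $\theta_c(z)=1$ if $z\ge c$. $R_\rho:[0,1)\to[0,1)$, $R_\rho(y)=\{y+\rho\}$, so $R_\rho^k(0)=\{k\rho\}$ for $k\in\mathbb{Z}$. For $\delta,a\in[0,1]$, let $F:\mathbb{R}\to\mathbb{R}$, $F(x)=\lambda x+\delta+(1-\lambda)\lfloor x\rfloor+d\,\theta_a(\{x\})$, and let $f_{\delta,a}:[0,1)\to[0,1)$, $f_{\delta,a}(x)=F(x)\pmod1$. Set $\Lambda=\bigcap_{n\in\mathbb{N}}f^n_{\delta,a}([0,1))$, $\eta_1=\frac{1-\delta-d}{\lambda}$ and $\eta_2=\frac{1-\delta}{\lambda}$. For $\rho,\alpha\in[0,1]$ define $$\delta(\rho,\alpha)=1-\lambda-d+\frac{1-\lambda}{\lambda}\sum_{k=1}^{\infty}\lambda^k\left((1-\lambda)\lfloor k\rho\rfloor+d\,\theta_{1-\alpha}(\{k\rho\})\right),$$ $$a(\delta,\rho,\alpha)=\frac{\delta}{1-\lambda}+\frac1\lambda\sum_{k=1}^{\infty}\lambda^k\left((1-\lambda)\lfloor\alpha-k\rho\rfloor+d\,\theta_\alpha(\{\alpha-k\rho\})\right)\quad\forall\delta\in[0,1].$$ For $\rho\in(0,1)$, $\delta(\rho^-,\alpha)=\lim_{r\to\rho^-}\delta(r,\alpha)$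 and $a(\delta,\rho^+,\alpha)=\lim_{r\to\rho^+}a(\delta,r,\alpha)$. The code of the orbit of $x$ with respect to a finite partition of $[0,1)$ into indexed intervals $I_0,I_1,(I_2)$ is the sequence $i=(i_n)_{n\in\mathbb{N}}$ with $f^n_{\delta,a}(x)\in I_{i_n}$ for every $n\in\mathbb{N}$. The complexity function of a sequence $i$ is $p_i(n)=\#\{i_ti_{t+1}\cdots i_{t+n-1}:t\ge0\}$, $n\ge1$. The discontinuities of $f_{\delta,a}$ are those as an interval map on $[0,1)$ (not as a circle map). *)

theory Defs
  imports "HOL-Analysis.Analysis"
begin

definition theta :: "real \<Rightarrow> real \<Rightarrow> real" where
  "theta c z = (if z < c then 0 else 1)"

definition rotation :: "real \<Rightarrow> real \<Rightarrow> real" where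
  "rotation \<rho> y = frac (y + \<rho>)"

text \<open>
  The integer powers (negative ones included) of the rotation, which is a bijection of
  \<open>[0,1)\<close>; the two lemmas below tie them to \<open>rotation\<close>.
\<close>

definition rotation_power :: "real \<Rightarrow> int \<Rightarrow> real \<Rightarrow> real" where
  "rotation_power \<rho> k y = frac (y + of_int k * \<rho>)"

lemma rotation_power_0: "y \<in> {0..<1} \<Longrightarrow> rotation_power \<rho> 0 y = y"
  by (simp add: rotation_power_def frac_eq)

lemma rotation_power_step:
  "rotation_power \<rho> (k + 1) y = rotation \<rho> (rotation_power \<rho> k y)"
proof -
  have "frac (frac z + \<rho>) = frac (z + \<rho>)" for z :: real
  proof -
    have "frac (w - of_int m) = frac w" for w :: real and m
      by (simp add: frac_def)
    from this[of "z + \<rho>" "\<lfloor>z\<rfloor>"] show ?thesis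
      by (simp add: frac_def algebra_simps)
  qed
  then show ?thesis
    by (simp add: rotation_power_def rotation_def algebra_simps)
qed

definition lift_map :: "real \<Rightarrow> real \<Rightarrow> real \<Rightarrow> real \<Rightarrow> real \<Rightarrow> real" where
  "lift_map l d \<delta> a x = l * x + \<delta> + (1 - l) * of_int \<lfloor>x\<rfloor> + d * theta a (frac x)"

text \<open>Only the restriction of \<open>contraction l d \<delta> a\<close> to \<open>[0,1)\<close> is meaningful.\<close>

definition contraction :: "real \<Rightarrow> real \<Rightarrow> real \<Rightarrow> real \<Rightarrow> real \<Rightarrow> real" where
  "contraction l d \<delta> a x = frac (lift_map l d \<delta> a x)"

definition attractor :: "(real \<Rightarrow> real) \<Rightarrow> real set" where
  "attractor f = (\<Inter>n. (f ^^ n) ` {0..<1})"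

definition delta_par :: "real \<Rightarrow> real \<Rightarrow> real \<Rightarrow> real \<Rightarrow> real" where
  "delta_par l d \<rho> \<alpha> =
     1 - l - d + (1 - l) / l *
       (\<Sum>k. l ^ Suc k * ((1 - l) * of_int \<lfloor>real (Suc k) * \<rho>\<rfloor>
                          + d * theta (1 - \<alpha>) (frac (real (Suc k) * \<rho>))))"

definition a_par :: "real \<Rightarrow> real \<Rightarrow> real \<Rightarrow> real \<Rightarrow> real \<Rightarrow> real" where
  "a_par l d \<delta> \<rho> \<alpha> =
     \<delta> / (1 - l) + 1 / l *
       (\<Sum>k. l ^ Suc k * ((1 - l) * of_int \<lfloor>\<alpha> - real (Suc k) * \<rho>\<rfloor>
                          + d * theta \<alpha> (frac (\<alpha> - real (Suc k) * \<rho>))))"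

text \<open>
  For \<open>0 < \<rho> < 1\<close> both one-sided limits exist, since each summand is a step function of \<open>\<rho>\<close>
  and the series converge locally uniformly.
\<close>

definition delta_par_left :: "real \<Rightarrow> real \<Rightarrow> real \<Rightarrow> real \<Rightarrow> real" where
  "delta_par_left l d \<rho> \<alpha> = Lim (at_left \<rho>) (\<lambda>r. delta_par l d r \<alpha>)"

definition a_par_right :: "real \<Rightarrow> real \<Rightarrow> real \<Rightarrow> real \<Rightarrow> real \<Rightarrow> real" where
  "a_par_right l d \<delta> \<rho> \<alpha> = Lim (at_right \<rho>) (\<lambda>r. a_par l d \<delta> r \<alpha>)"

definition eta :: "real \<Rightarrow> real \<Rightarrow> real \<Rightarrow> real \<Rightarrow> real \<Rightarrow> real \<Rightarrow> real" where
  "eta l d \<delta> a \<rho> \<alpha> =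
     (if \<alpha> < 1 - \<rho> then (1 - \<delta> - d) / l
      else if \<alpha> = 1 - \<rho> then a
      else (1 - \<delta>) / l)"

text \<open>
  The partition of \<open>[0,1)\<close> into left-closed right-open intervals cut at the points of a finite
  set, listed from left to right.  Cut points outside the open interval \<open>(0,1)\<close> (such as
  \<open>a = 0\<close> or \<open>a = 1\<close>) do not produce an interval.
\<close>

definition cut_partition :: "real set \<Rightarrow> real set list" where
  "cut_partition C =
     (let cs = sorted_list_of_set (insert 0 (C \<inter> {0<..<1}))
      in map2 (\<lambda>u v. {u..<v}) cs (tl cs @ [1]))"

text \<open>
  Continuity is relative to the subspace \<open>[0,1)\<close> of the line with values in the line, so that
  a jump from 1 to 0 is a discontinuity and nothing is compared across the ends 0 and 1.
\<close>

definition discontinuities :: "(real \<Rightarrow> real) \<Rightarrow> real set" where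
  "discontinuities f = {y \<in> {0..<1}. \<not> continuous (at y within {0..<1}) f}"

definition orbit_code :: "(real \<Rightarrow> real) \<Rightarrow> real set list \<Rightarrow> real \<Rightarrow> nat \<Rightarrow> nat" where
  "orbit_code f P x n = (THE i. i < length P \<and> (f ^^ n) x \<in> P ! i)"

definition complexity :: "(nat \<Rightarrow> 'a) \<Rightarrow> nat \<Rightarrow> nat" where
  "complexity s n = card (range (\<lambda>t. map s [t..<t + n]))"

definition complexity_offset :: "int \<Rightarrow> nat" where
  "complexity_offset k =
     (if k \<le> -2 then nat \<bar>k\<bar> else if k \<in> {-1, 0} then 1 else nat (k + 1))"

end

theory Submission
  imports Defs
begin

text \<open>
  The increasing function \<open>\<phi>\<close> with \<open>\<phi>(y) = \<delta>/(1-\<lambda>) + \<lambda>\<^sup>-\<^sup>1 \<Sum>\<^sub>k \<lambda>\<^sup>k ((1-\<lambda>)\<lfloor>y-k\<rho>\<rfloor> + d \<theta>\<^sub>\<alpha>({y-k\<rho>}))\<close>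
  satisfies \<open>F(\<phi>(y)) = \<phi>(y+\<rho>)\<close> as soon as \<open>\<phi>(y) \<ge> 0\<close> iff \<open>y \<ge> 0\<close> and \<open>\<phi>(y) \<ge> a\<close> iff \<open>y \<ge> \<alpha>\<close>;
  the parameter intervals say exactly this, their end points being one-sided limits of \<open>\<phi>\<close> at
  \<open>0\<close> and \<open>\<alpha>\<close>. Every point of \<open>\<Lambda>\<close> has a full backward orbit and therefore lies in \<open>\<phi>([0,1))\<close>.
  Since \<open>F(\<phi>(y)) \<ge> 1\<close> iff \<open>y \<ge> 1-\<rho>\<close>, the code of \<open>\<phi>(y)\<close> is the code of \<open>y\<close> under the rotation, for the
  partition cut at \<open>\<alpha>\<close> and \<open>1-\<rho>\<close>. Its words of length \<open>n\<close> correspond to the intervals between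
  consecutive points of the set of all \<open>{-j\<rho>}\<close>, \<open>0 \<le> j \<le> n\<close>, and \<open>{\<alpha>-j\<rho>}\<close>, \<open>0 \<le> j < n\<close>, and the
  complexity is the cardinality of this set.
\<close>

subsection \<open>Fractional parts and staircase functions\<close>

lemma floor_diff_unit_interval:
  fixes c q :: real
  assumes "0 \<le> c" "c \<le> 1"
  shows "\<lfloor>q - c\<rfloor> = \<lfloor>q\<rfloor> - (if frac q < c then 1 else 0)"
  using assms by (auto simp: frac_def intro!: floor_unique split: if_splits) linarith+

text \<open>Kronecker's theorem approximates the fractional part of the midpoint to within half the
  length; an integer shift returns to the interval.\<close>

lemma irrational_multiple_between:
  fixes \<rho> u v :: real
  assumes "\<rho> \<notin> \<rat>" "u < v"
  obtains k :: nat and m :: int where "k > 0" "u < real_of_int m + real k * \<rho>" "real_of_int m + real k * \<rho> < v"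
proof -
  let ?c = "(u + v) / 2"
  obtain k where k: "k > 0" "\<bar>frac (real k * \<rho>) - frac ?c\<bar> < (v - u) / 2"
    using Kronecker_approx_1_explicit[OF assms(1), of "frac ?c" "(v - u) / 2"] assms(2)
    by (auto simp: less_imp_le[OF frac_lt_1])
  have "\<bar>(of_int (\<lfloor>?c\<rfloor> - \<lfloor>real k * \<rho>\<rfloor>) + real k * \<rho>) - ?c\<bar> < (v - u) / 2"
    using k(2) by (simp add: frac_def algebra_simps)
  then show thesis
    using that[OF k(1), of "\<lfloor>?c\<rfloor> - \<lfloor>real k * \<rho>\<rfloor>"] by (auto simp: abs_less_iff field_simps)
qed

lemma frac_diff_of_int [simp]: "frac (x - of_int m) = frac (x :: real)"
  by (simp add: frac_def)

lemma frac_irrational_multiple_eq_iff: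
  fixes \<rho> :: real
  assumes "\<rho> \<notin> \<rat>"
  shows "frac (of_int i * \<rho>) = frac (of_int j * \<rho>) \<longleftrightarrow> i = j"
proof
  assume "frac (of_int i * \<rho>) = frac (of_int j * \<rho>)"
  then have "of_int (i - j) * \<rho> = of_int (\<lfloor>of_int i * \<rho>\<rfloor> - \<lfloor>of_int j * \<rho>\<rfloor>)"
    by (simp add: frac_def algebra_simps)
  then have *: "of_int (i - j) * \<rho> \<in> \<rat>"
    by simp
  show "i = j"
  proof (rule ccontr)
    assume "i \<noteq> j"
    then have "\<rho> = (of_int (i - j) * \<rho>) / of_int (i - j)"
      by simp
    also have "\<dots> \<in> \<rat>"
      using * by (intro Rats_divide) auto
    finally show False
      using assms by simp
  qed
qed simp

lemma frac_add_frac_left: "frac (frac x + y) = frac (x + y :: real)"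
  using frac_diff_of_int[of "x + y" "\<lfloor>x\<rfloor>"] by (simp add: frac_def[of x] algebra_simps)

lemma inj_frac_irrational_multiple:
  fixes \<rho> :: real
  assumes "\<rho> \<notin> \<rat>"
  shows "inj_on (\<lambda>i::int. frac (of_int i * \<rho>)) A"
  by (rule inj_onI) (simp add: frac_irrational_multiple_eq_iff[OF assms])

text \<open>The non-affine part of \<open>lift_map\<close>. With cut \<open>1 - \<alpha>\<close> or
  \<open>\<alpha>\<close> it is also the bracket in the series of \<open>delta_par\<close> and
  \<open>a_par\<close>.\<close>

definition stair :: "real \<Rightarrow> real \<Rightarrow> real \<Rightarrow> real \<Rightarrow> real" where
  "stair l d c z = (1 - l) * of_int \<lfloor>z\<rfloor> + d * theta c (frac z)"

lemma lift_map_stair: "lift_map l d \<delta> a x = l * x + \<delta> + stair l d a x"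
  by (simp add: lift_map_def stair_def)

lemma stair_add_of_int: "stair l d c (z + of_int m) = stair l d c z + (1 - l) * of_int m"
  by (simp add: stair_def algebra_simps)

text \<open>A staircase only sees how its argument lies relative to the integers and to the
  translates of its cut. This lets the cut \<open>a\<close> be traded for \<alpha>.\<close>

lemma stair_cong:
  assumes "\<And>m::int. of_int m \<le> x \<longleftrightarrow> of_int m \<le> w"
    and "\<And>m::int. a + of_int m \<le> x \<longleftrightarrow> c + of_int m \<le> w"
  shows "stair l d a x = stair l d c w"
proof -
  have f: "\<lfloor>x\<rfloor> = \<lfloor>w\<rfloor>"
    using assms(1)[of "\<lfloor>x\<rfloor>"] assms(1)[of "\<lfloor>w\<rfloor>"] by (intro order.antisym) (simp_all add: le_floor_iff)
  have "frac x < a \<longleftrightarrow> frac w < c"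
    using assms(2)[of "\<lfloor>x\<rfloor>"] by (auto simp: frac_def f)
  then show ?thesis
    by (simp add: stair_def theta_def f)
qed

section \<open>Monotonicity and reflection of staircases\<close>

context
  fixes l d :: real
  assumes l: "l \<in> {0<..<1}" and d: "d \<in> {0<..<1 - l}"
begin

text \<open>Crossing an integer gains at least \<open>1 - l\<close>, while falling back below the
  cut costs at most \<open>d < 1 - l\<close>.\<close>

lemma stair_mono:
  assumes "x \<le> y"
  shows "stair l d c x \<le> stair l d c y"
proof (cases "\<lfloor>x\<rfloor> = \<lfloor>y\<rfloor>")
  case True
  then show ?thesis
    using assms d by (auto simp: stair_def theta_def frac_def)
next
  case False
  then have "\<lfloor>x\<rfloor> + 1 \<le> \<lfloor>y\<rfloor>"
    using floor_mono[OF assms] by simp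
  then have "(1 - l) * (of_int \<lfloor>x\<rfloor> + 1) \<le> (1 - l) * of_int \<lfloor>y\<rfloor>"
    using l by (intro mult_left_mono) auto
  moreover have "d * theta c (frac x) \<le> 1 - l" "0 \<le> d * theta c (frac y)"
    using d by (auto simp: theta_def)
  ultimately show ?thesis
    by (simp add: stair_def algebra_simps)
qed

lemma stair_less_of_int_between:
  assumes "x < of_int m" "of_int m \<le> y"
  shows "stair l d c x < stair l d c y"
proof -
  have "\<lfloor>x\<rfloor> + 1 \<le> \<lfloor>y\<rfloor>"
    using assms floor_less_iff[of x m] le_floor_iff[of m y] by linarith
  then have "(1 - l) * (of_int \<lfloor>x\<rfloor> + 1) \<le> (1 - l) * of_int \<lfloor>y\<rfloor>"
    using l by (intro mult_left_mono) auto
  moreover have "d * theta c (frac x) < 1 - l" "0 \<le> d * theta c (frac y)"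
    using l d by (auto simp: theta_def)
  ultimately show ?thesis
    by (simp add: stair_def algebra_simps)
qed

text \<open>The floors add up to at most -1. If they add up to -1, the fractional parts sum to less
  than 1 and at most one cut is passed; otherwise a further \<open>1 - l\<close> is lost, which
  outweighs the second \<open>d\<close>.\<close>

lemma stair_reflect_le:
  assumes "w + z < 0"
  shows "stair l d c w + stair l d (1 - c) z \<le> d - (1 - l)"
proof (cases "\<lfloor>w\<rfloor> + \<lfloor>z\<rfloor> = -1")
  case True
  then have "of_int \<lfloor>w\<rfloor> + of_int \<lfloor>z\<rfloor> = (-1 :: real)"
    by linarith
  then have "frac w + frac z < 1"
    using assms by (simp add: frac_def)
  then have "theta c (frac w) + theta (1 - c) (frac z) \<le> 1"
    by (auto simp: theta_def)
  then have "d * (theta c (frac w) + theta (1 - c) (frac z)) \<le> d * 1"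
    using d by (intro mult_left_mono) auto
  moreover have "(1 - l) * of_int \<lfloor>w\<rfloor> + (1 - l) * of_int \<lfloor>z\<rfloor> = - (1 - l)"
    using \<open>of_int \<lfloor>w\<rfloor> + of_int \<lfloor>z\<rfloor> = (-1 :: real)\<close> by (simp flip: distrib_left)
  ultimately show ?thesis
    by (simp add: stair_def algebra_simps)
next
  case False
  moreover have "\<lfloor>w\<rfloor> + \<lfloor>z\<rfloor> < 0"
    using assms by linarith
  ultimately have "of_int \<lfloor>w\<rfloor> + of_int \<lfloor>z\<rfloor> \<le> (-2 :: real)"
    by linarith
  then have "(1 - l) * (of_int \<lfloor>w\<rfloor> + of_int \<lfloor>z\<rfloor>) \<le> (1 - l) * (-2)"
    using l by (intro mult_left_mono) auto
  moreover have "d * theta c (frac w) \<le> d" "d * theta (1 - c) (frac z) \<le> d"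
    using d by (auto simp: theta_def)
  moreover have "d < 1 - l"
    using d by simp
  ultimately show ?thesis
    by (simp add: stair_def algebra_simps)
qed

end

text \<open>Off the jumps, the floors of \<open>z\<close> and \<open>- z\<close> add up to -1 and
  exactly one of the two cuts is passed.\<close>

lemma stair_reflect_eq:
  assumes "z \<notin> \<int>" "frac z \<noteq> 1 - c"
  shows "stair l d c (- z) + stair l d (1 - c) z = d - (1 - l)"
proof -
  have fl: "\<lfloor>- z\<rfloor> = - \<lfloor>z\<rfloor> - 1"
    using assms(1) by (simp add: floor_minus ceiling_altdef) (metis Ints_of_int)
  have fr: "frac (- z) = 1 - frac z"
    using assms(1) by (simp add: frac_neg)
  have th: "theta (1 - c) (frac z) = 1 - theta c (1 - frac z)"
    using assms(2) by (auto simp: theta_def)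
  show ?thesis
    unfolding stair_def fl fr th by (simp add: algebra_simps)
qed

text \<open>The left limit of a staircase at \<open>w\<close> is attained just before \<open>w\<close>, and it is given by the
  reflected staircase, which is right continuous at \<open>-w\<close>.\<close>

lemma stair_left_limit:
  obtains t where "t < w"
    "\<And>s. t < s \<Longrightarrow> s < w \<Longrightarrow> stair l d c s = d - (1 - l) - stair l d (1 - c) (-w)"
proof -
  \<comment> \<open>\<open>n\<close> is the largest integer strictly below \<open>w\<close>, also
    for integral \<open>w\<close>; \<open>t\<close> will be the last possible jump before
    \<open>w\<close>.\<close>
  define n where "n = \<lceil>w\<rceil> - 1"
  have n: "of_int n < w" "w \<le> of_int n + 1"
    unfolding n_def by linarith+
  define t where "t = (if w - of_int n > c then max (of_int n) (of_int n + c) else of_int n)"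
  have "t < w"
    using n by (auto simp: t_def)
  moreover have "stair l d c s = d - (1 - l) - stair l d (1 - c) (-w)" if s: "t < s" "s < w" for s
  proof -
    have sn: "of_int n < s"
      using s by (auto simp: t_def split: if_splits)
    have fs: "\<lfloor>s\<rfloor> = n"
      using sn s n by (intro floor_unique) auto
    have fw: "\<lfloor>-w\<rfloor> = - n - 1"
      using n by (intro floor_unique) auto
    have "theta c (s - of_int n) = 1 - theta (1 - c) (of_int n + 1 - w)"
      using s by (auto simp: theta_def t_def split: if_splits)
    then have "d * theta c (s - of_int n) = d * (1 - theta (1 - c) (of_int n + 1 - w))"
      by simp
    then show ?thesis
      by (simp add: stair_def fs fw frac_def algebra_simps)
  qed
  ultimately show thesis
    using that by blast
qed

lemma eventually_stair_at_left:
  assumes "k > 0"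
  shows "\<forall>\<^sub>F r in at_left \<rho>. stair l d c (k * r) = d - (1 - l) - stair l d (1 - c) (- (k * \<rho>))"
proof -
  obtain t where t: "t < k * \<rho>"
    "\<And>s. t < s \<Longrightarrow> s < k * \<rho> \<Longrightarrow> stair l d c s = d - (1 - l) - stair l d (1 - c) (- (k * \<rho>))"
    by (rule stair_left_limit[of "k * \<rho>" l d c]) blast
  show ?thesis
    unfolding eventually_at_left_field
    using assms t by (intro exI[of _ "t / k"]) (auto simp: field_simps intro!: t(2))
qed

text \<open>Raising \<open>r\<close> lowers \<open>y - k * r\<close>, so a right limit in the
  rotation number is a left limit of the staircase.\<close>

lemma eventually_stair_at_right:
  assumes "k > 0"
  shows "\<forall>\<^sub>F r in at_right \<rho>. stair l d c (y - k * r) = d - (1 - l) - stair l d (1 - c) (k * \<rho> - y)"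
proof -
  obtain t where t: "t < y - k * \<rho>"
    "\<And>s. t < s \<Longrightarrow> s < y - k * \<rho> \<Longrightarrow> stair l d c s = d - (1 - l) - stair l d (1 - c) (- (y - k * \<rho>))"
    by (rule stair_left_limit[of "y - k * \<rho>" l d c]) blast
  show ?thesis
    unfolding eventually_at_right_field
  proof (intro exI[of _ "(y - t) / k"] conjI allI impI)
    show "\<rho> < (y - t) / k"
      using t(1) assms by (simp add: field_simps)
    fix r assume "\<rho> < r" "r < (y - t) / k"
    then have "t < y - k * r" "y - k * r < y - k * \<rho>"
      using assms by (auto simp: field_simps)
    then show "stair l d c (y - k * r) = d - (1 - l) - stair l d (1 - c) (k * \<rho> - y)"
      using t(2)[of "y - k * r"] by simp
  qed
qed

section \<open>Convergence of staircase series\<close>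

lemma abs_stair_le:
  assumes "l \<in> {0<..<1}" "d \<in> {0<..<1 - l}"
  shows "\<bar>stair l d c z\<bar> \<le> \<bar>z\<bar> + 2"
proof -
  have "\<bar>(1 - l) * of_int \<lfloor>z\<rfloor>\<bar> \<le> 1 * \<bar>of_int \<lfloor>z\<rfloor>\<bar>"
    using assms unfolding abs_mult by (intro mult_right_mono) auto
  moreover have "\<bar>of_int \<lfloor>z\<rfloor> :: real\<bar> \<le> \<bar>z\<bar> + 1"
    by linarith
  moreover have "\<bar>d * theta c (frac z)\<bar> \<le> 1"
    using assms by (auto simp: theta_def)
  ultimately show ?thesis
    unfolding stair_def by linarith
qed

lemma summable_power_linear:
  fixes l C :: real
  assumes "0 < l" "l < 1"
  shows "summable (\<lambda>k. l ^ Suc k * (real (Suc k) + C))"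
proof -
  have "summable (\<lambda>k. real (Suc k) * l ^ k)"
    using geometric_deriv_sums[of l] assms by (auto simp: sums_iff)
  from summable_mult[OF this, of l] have "summable (\<lambda>k. real (Suc k) * l ^ Suc k)"
    by (simp add: mult_ac)
  moreover have "summable (\<lambda>k. C * l ^ Suc k)"
    using assms by (intro summable_mult) (subst summable_Suc_iff, simp)
  ultimately have "summable (\<lambda>k. real (Suc k) * l ^ (Suc k) + C * l ^ Suc k)"
    by (rule summable_add)
  then show ?thesis
    by (simp add: algebra_simps)
qed

lemma abs_summand_le:
  assumes "l \<in> {0<..<1}" "d \<in> {0<..<1 - l}" "\<bar>z\<bar> \<le> real (Suc k) + C"
  shows "norm (l ^ Suc k * stair l d c z) \<le> l ^ Suc k * (real (Suc k) + (C + 2))"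
proof -
  have "\<bar>stair l d c z\<bar> \<le> real (Suc k) + (C + 2)"
    using abs_stair_le[OF assms(1,2), of c z] assms(3) by linarith
  then have "l ^ Suc k * \<bar>stair l d c z\<bar> \<le> l ^ Suc k * (real (Suc k) + (C + 2))"
    using assms(1) by (intro mult_left_mono) auto
  then show ?thesis
    using assms(1) by (simp add: abs_mult)
qed

lemma abs_diff_mult_le:
  fixes r :: real
  assumes "r \<in> {0<..<1}"
  shows "\<bar>y - real (Suc k) * r\<bar> \<le> real (Suc k) + \<bar>y\<bar>"
proof -
  have "real (Suc k) * r \<le> real (Suc k)" "0 \<le> real (Suc k) * r"
    using assms by (auto intro: mult_left_le simp del: of_nat_Suc)
  then show ?thesis
    by linarith
qed

text \<open>Tannery's theorem: each summand is eventually constant in \<open>r\<close>, and the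
  linear bound on \<open>g\<close> gives a dominating series independent of
  \<open>r\<close>.\<close>

lemma tendsto_stair_series:
  assumes "l \<in> {0<..<1}" "d \<in> {0<..<1 - l}" "F \<noteq> bot"
    and ev: "\<And>k. \<forall>\<^sub>F r in F. stair l d c (g k r) = b k"
    and bd: "\<forall>\<^sub>F r in F. \<forall>k. \<bar>g k r\<bar> \<le> real (Suc k) + C"
  shows "summable (\<lambda>k. l ^ Suc k * b k)"
    "((\<lambda>r. \<Sum>k. l ^ Suc k * stair l d c (g k r)) \<longlongrightarrow> (\<Sum>k. l ^ Suc k * b k)) F"
proof -
  have "((\<lambda>r. l ^ Suc k * stair l d c (g k r)) \<longlongrightarrow> l ^ Suc k * b k) F" for k
    using ev[of k] by (intro tendsto_mult_left tendsto_eventually)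
  moreover have "eventually (\<lambda>(k, r). norm (l ^ Suc k * stair l d c (g k r))
      \<le> l ^ Suc k * (real (Suc k) + (C + 2))) (at_top \<times>\<^sub>F F)"
  proof -
    have "eventually (\<lambda>(k :: nat, r). \<forall>k. \<bar>g k r\<bar> \<le> real (Suc k) + C) (at_top \<times>\<^sub>F F)"
      using bd by (subst eventually_prod2) auto
    then show ?thesis
    proof (rule eventually_mono, clarify)
      fix k r
      assume "\<forall>k. \<bar>g k r\<bar> \<le> real (Suc k) + C"
      then show "norm (l ^ Suc k * stair l d c (g k r)) \<le> l ^ Suc k * (real (Suc k) + (C + 2))"
        using abs_summand_le[OF assms(1,2)] by blast
    qed
  qed
  ultimately have *: "summable (\<lambda>k. norm (l ^ Suc k * b k)) \<and>
    ((\<lambda>r. \<Sum>k. l ^ Suc k * stair l d c (g k r)) \<longlongrightarrow> (\<Sum>k. l ^ Suc k * b k)) F"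
    using tannerys_theorem[of "\<lambda>k r. l ^ Suc k * stair l d c (g k r)" "\<lambda>k. l ^ Suc k * b k" F]
      summable_power_linear[of l "C + 2"] assms(1,3) by simp
  show "summable (\<lambda>k. l ^ Suc k * b k)"
    by (rule summable_norm_cancel[OF conjunct1[OF *]])
  show "((\<lambda>r. \<Sum>k. l ^ Suc k * stair l d c (g k r)) \<longlongrightarrow> (\<Sum>k. l ^ Suc k * b k)) F"
    by (rule conjunct2[OF *])
qed

subsection \<open>The semiconjugacy with the rotation\<close>

locale quasiperiodic_contraction =
  fixes l d \<rho> \<alpha> \<delta> a :: real
  assumes l: "l \<in> {0<..<1}"
    and d: "d \<in> {0<..<1 - l}"
    and \<rho>: "\<rho> \<in> {0<..<1}" and irrational: "\<rho> \<notin> \<rat>"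
    and \<alpha>: "\<alpha> \<in> {0..1}"
    and \<delta>: "\<delta> \<in> {1 - l - d<..<1}"
    and a: "a \<in> {0..1}"
    and \<delta>_par: "\<delta> \<in> {delta_par_left l d \<rho> \<alpha>..delta_par l d \<rho> \<alpha>}"
    and a_par: "a \<in> {a_par_right l d \<delta> \<rho> \<alpha>..a_par l d \<delta> \<rho> \<alpha>}"
begin

text \<open>\<open>semiconj\<close> sums the backward itinerary of a point under the rotation. At \<open>\<alpha>\<close> it is
  \<open>a_par\<close>, and the two parameter intervals express that \<open>semiconj\<close> passes \<open>0\<close> at \<open>0\<close> and
  \<open>a\<close> at \<open>\<alpha>\<close>.\<close>

definition semiconj :: "real \<Rightarrow> real" where
  "semiconj y = \<delta> / (1 - l) + 1 / l * (\<Sum>k. l ^ Suc k * stair l d \<alpha> (y - real (Suc k) * \<rho>))"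

lemma summable_stair: "summable (\<lambda>k. l ^ Suc k * stair l d \<alpha> (y - real (Suc k) * \<rho>))"
proof (rule summable_comparison_test')
  show "summable (\<lambda>k. l ^ Suc k * (real (Suc k) + (\<bar>y\<bar> + 2)))"
    using l by (intro summable_power_linear) auto
  show "norm (l ^ Suc k * stair l d \<alpha> (y - real (Suc k) * \<rho>)) \<le> l ^ Suc k * (real (Suc k) + (\<bar>y\<bar> + 2))" for k
    by (rule abs_summand_le[OF l d abs_diff_mult_le[OF \<rho>]])
qed

lemma summable_stair_rotation: "summable (\<lambda>k. l ^ Suc k * stair l d c (real (Suc k) * \<rho>))"
proof (rule summable_comparison_test')
  show "summable (\<lambda>k. l ^ Suc k * (real (Suc k) + (0 + 2)))"
    using l by (intro summable_power_linear) auto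
  show "norm (l ^ Suc k * stair l d c (real (Suc k) * \<rho>)) \<le> l ^ Suc k * (real (Suc k) + (0 + 2))" for k
    using abs_diff_mult_le[OF \<rho>, of 0 k] by (intro abs_summand_le[OF l d]) simp
qed

lemma sums_geometric: "(\<lambda>k. l ^ Suc k * C) sums (l / (1 - l) * C)"
proof -
  have "(\<lambda>k. l * l ^ k * C) sums (l * (1 / (1 - l)) * C)"
    using l by (intro sums_mult sums_mult2 geometric_sums) auto
  then show ?thesis
    by simp
qed

text \<open>Splitting off the first term leaves \<open>l\<close> times the series at
  \<open>w - \<rho>\<close>. The constant \<open>\<delta> / (1 - l)\<close> is the solution of
  \<open>c = l * c + \<delta>\<close>.\<close>

lemma semiconj_rec: "semiconj w = l * semiconj (w - \<rho>) + \<delta> + stair l d \<alpha> (w - \<rho>)"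
proof -
  let ?T = "\<lambda>w k. l ^ Suc k * stair l d \<alpha> (w - real (Suc k) * \<rho>)"
  have "(\<Sum>k. ?T w k) = ?T w 0 + (\<Sum>k. ?T w (Suc k))"
    using suminf_split_head[OF summable_stair[of w]] by simp
  also have "(\<lambda>k. ?T w (Suc k)) = (\<lambda>k. l * ?T (w - \<rho>) k)"
    by (auto simp: algebra_simps)
  also have "(\<Sum>k. l * ?T (w - \<rho>) k) = l * (\<Sum>k. ?T (w - \<rho>) k)"
    by (rule suminf_mult[OF summable_stair])
  finally have "semiconj w = \<delta> / (1 - l) + stair l d \<alpha> (w - \<rho>) + (\<Sum>k. ?T (w - \<rho>) k)"
    using l by (simp add: semiconj_def field_simps)
  moreover have "l * semiconj (w - \<rho>) = l * \<delta> / (1 - l) + (\<Sum>k. ?T (w - \<rho>) k)"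
    using l by (simp add: semiconj_def distrib_left)
  moreover have "\<delta> / (1 - l) - l * \<delta> / (1 - l) = \<delta> * (1 - l) / (1 - l)"
    by (simp add: algebra_simps flip: diff_divide_distrib)
  moreover have "\<delta> * (1 - l) / (1 - l) = \<delta>"
    using l by simp
  ultimately show ?thesis
    by linarith
qed

lemma semiconj_add_of_int: "semiconj (y + of_int m) = semiconj y + of_int m"
proof -
  let ?T = "\<lambda>w k. l ^ Suc k * stair l d \<alpha> (w - real (Suc k) * \<rho>)"
  have "?T (y + of_int m) k = ?T y k + l ^ Suc k * ((1 - l) * of_int m)" for k
    using stair_add_of_int[of l d \<alpha> "y - real (Suc k) * \<rho>" m]
    by (simp add: diff_add_eq distrib_left del: power_Suc of_nat_Suc)
  then have "(\<Sum>k. ?T (y + of_int m) k) = (\<Sum>k. ?T y k + l ^ Suc k * ((1 - l) * of_int m))"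
    by simp
  also have "\<dots> = (\<Sum>k. ?T y k) + l / (1 - l) * ((1 - l) * of_int m)"
    by (intro sums_unique[symmetric] sums_add summable_sums[OF summable_stair] sums_geometric)
  finally show ?thesis
    using l by (simp add: semiconj_def field_simps)
qed

text \<open>All summands are monotone. By density some \<open>m + k * \<rho>\<close> separates the
  two points, and the summand belonging to \<open>k * \<rho>\<close> then passes the integer
  \<open>m\<close>.\<close>

lemma semiconj_strict_mono: "strict_mono semiconj"
proof
  fix y y' :: real
  assume "y < y'"
  obtain k m where k: "k > 0" and between: "y < of_int m + real k * \<rho>" "of_int m + real k * \<rho> < y'"
    using irrational_multiple_between[OF irrational \<open>y < y'\<close>] .
  obtain i where i: "k = Suc i"
    using k by (cases k) auto
  let ?T = "\<lambda>y k. l ^ Suc k * stair l d \<alpha> (y - real (Suc k) * \<rho>)"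
  have "0 < (\<Sum>k. ?T y' k - ?T y k)"
  proof (rule suminf_pos2[where i = i])
    show "summable (\<lambda>k. ?T y' k - ?T y k)"
      by (rule summable_diff[OF summable_stair summable_stair])
    have "?T y k \<le> ?T y' k" for k
      using l \<open>y < y'\<close> by (intro mult_left_mono stair_mono[OF l d]) auto
    then show "0 \<le> ?T y' k - ?T y k" for k
      by simp
    have "?T y i < ?T y' i"
      using l between unfolding i
      by (intro mult_strict_left_mono stair_less_of_int_between[OF l d, where m = m]) auto
    then show "0 < ?T y' i - ?T y i"
      by simp
  qed
  also have "\<dots> = (\<Sum>k. ?T y' k) - (\<Sum>k. ?T y k)"
    by (rule suminf_diff[OF summable_stair summable_stair, symmetric])
  finally have "(\<Sum>k. ?T y k) < (\<Sum>k. ?T y' k)"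
    by simp
  then show "semiconj y < semiconj y'"
    using l by (simp add: semiconj_def divide_strict_right_mono)
qed

lemma semiconj_less_iff [simp]: "semiconj y < semiconj y' \<longleftrightarrow> y < y'"
  by (rule strict_mono_less[OF semiconj_strict_mono])

lemma semiconj_le_iff [simp]: "semiconj y \<le> semiconj y' \<longleftrightarrow> y \<le> y'"
  by (rule strict_mono_less_eq[OF semiconj_strict_mono])

section \<open>Position of the semiconjugacy relative to \<open>0\<close> and
  \<open>a\<close>\<close>

text \<open>Reflection turns the left limit of each term of \<open>delta_par\<close> into a term of
  the series at 0, so the lower bound on \<delta> gives the sign.\<close>

lemma semiconj_0_nonneg: "0 \<le> semiconj 0"
proof -
  let ?T = "\<lambda>k. l ^ Suc k * stair l d \<alpha> (0 - real (Suc k) * \<rho>)"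
  let ?b = "\<lambda>k. d - (1 - l) - stair l d \<alpha> (0 - real (Suc k) * \<rho>)"
  have "((\<lambda>r. \<Sum>k. l ^ Suc k * stair l d (1 - \<alpha>) (real (Suc k) * r)) \<longlongrightarrow> (\<Sum>k. l ^ Suc k * ?b k)) (at_left \<rho>)"
  proof (rule tendsto_stair_series(2)[OF l d])
    show "\<forall>\<^sub>F r in at_left \<rho>. stair l d (1 - \<alpha>) (real (Suc k) * r) = ?b k" for k
      using eventually_stair_at_left[of "real (Suc k)" l d "1 - \<alpha>" \<rho>] by simp
    show "\<forall>\<^sub>F r in at_left \<rho>. \<forall>k. \<bar>real (Suc k) * r\<bar> \<le> real (Suc k) + 0"
      using eventually_at_left_real[of 0 \<rho>] \<rho>
      by (auto elim!: eventually_mono intro: mult_left_le simp: abs_mult simp del: of_nat_Suc)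
  qed simp
  moreover have "(\<Sum>k. l ^ Suc k * ?b k) = l / (1 - l) * (d - (1 - l)) - (\<Sum>k. ?T k)"
  proof -
    have "(\<lambda>k. l ^ Suc k * (d - (1 - l)) - ?T k) sums (l / (1 - l) * (d - (1 - l)) - (\<Sum>k. ?T k))"
      by (intro sums_diff sums_geometric summable_sums[OF summable_stair])
    then show ?thesis
      unfolding right_diff_distrib[of _ "d - (1 - l)"] by (rule sums_unique[symmetric])
  qed
  ultimately have "((\<lambda>r. delta_par l d r \<alpha>) \<longlongrightarrow> 1 - l - d + (1 - l) / l * (l / (1 - l) * (d - (1 - l)) - (\<Sum>k. ?T k))) (at_left \<rho>)"
    unfolding delta_par_def stair_def[symmetric] by (intro tendsto_intros) simp
  then have "delta_par_left l d \<rho> \<alpha> = 1 - l - d + (1 - l) / l * (l / (1 - l) * (d - (1 - l)) - (\<Sum>k. ?T k))"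
    unfolding delta_par_left_def by (intro tendsto_Lim) auto
  also have "\<dots> = - ((1 - l) / l * (\<Sum>k. ?T k))"
    using l by (simp add: right_diff_distrib)
  finally have "0 \<le> \<delta> + (1 - l) / l * (\<Sum>k. ?T k)"
    using \<delta>_par by simp
  then have "0 \<le> (\<delta> + (1 - l) / l * (\<Sum>k. ?T k)) / (1 - l)"
    using l by (intro divide_nonneg_pos) auto
  also have "\<dots> = semiconj 0"
    using l by (simp add: semiconj_def add_divide_distrib)
  finally show ?thesis .
qed

text \<open>The reflection inequality bounds the series below 0 by that of \<open>delta_par\<close>,
  so that the upper bound on \<delta> applies.\<close>

lemma semiconj_neg:
  assumes "y < 0"
  shows "semiconj y < 0"
proof -
  \<comment> \<open>The comparison yields only a weak inequality; making it at the half and using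
    strict monotonicity gives the strict one.\<close>
  let ?y = "y / 2"
  let ?T = "\<lambda>k. l ^ Suc k * stair l d \<alpha> (?y - real (Suc k) * \<rho>)"
  let ?G = "\<lambda>k. l ^ Suc k * stair l d (1 - \<alpha>) (real (Suc k) * \<rho>)"
  have "(\<Sum>k. ?T k) \<le> l / (1 - l) * (d - (1 - l)) - (\<Sum>k. ?G k)"
  proof (rule sums_le[OF _ summable_sums[OF summable_stair]])
    show "(\<lambda>k. l ^ Suc k * (d - (1 - l)) - ?G k) sums (l / (1 - l) * (d - (1 - l)) - (\<Sum>k. ?G k))"
      by (intro sums_diff sums_geometric summable_sums[OF summable_stair_rotation])
    fix k
    have "stair l d \<alpha> (?y - real (Suc k) * \<rho>) + stair l d (1 - \<alpha>) (real (Suc k) * \<rho>) \<le> d - (1 - l)"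
      using assms by (intro stair_reflect_le[OF l d]) auto
    then have "l ^ Suc k * stair l d \<alpha> (?y - real (Suc k) * \<rho>)
        \<le> l ^ Suc k * (d - (1 - l) - stair l d (1 - \<alpha>) (real (Suc k) * \<rho>))"
      using l by (intro mult_left_mono) auto
    then show "?T k \<le> l ^ Suc k * (d - (1 - l)) - ?G k"
      by (simp add: right_diff_distrib)
  qed
  then have "(1 - l) / l * (\<Sum>k. ?T k) \<le> (1 - l) / l * (l / (1 - l) * (d - (1 - l)) - (\<Sum>k. ?G k))"
    using l by (intro mult_left_mono) auto
  also have "\<dots> = d - (1 - l) - (1 - l) / l * (\<Sum>k. ?G k)"
    using l by (simp add: right_diff_distrib)
  finally have "\<delta> + (1 - l) / l * (\<Sum>k. ?T k) \<le> 0"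
    using \<delta>_par by (simp add: delta_par_def stair_def)
  then have "(\<delta> + (1 - l) / l * (\<Sum>k. ?T k)) / (1 - l) \<le> 0"
    using l by (intro divide_nonpos_pos) auto
  also have "(\<delta> + (1 - l) / l * (\<Sum>k. ?T k)) / (1 - l) = semiconj ?y"
    using l by (simp add: semiconj_def add_divide_distrib)
  finally show ?thesis
    using semiconj_less_iff[of y ?y] assms by linarith
qed

lemma a_par_eq_semiconj: "a_par l d \<delta> \<rho> \<alpha> = semiconj \<alpha>"
  by (simp add: a_par_def semiconj_def stair_def)

lemma a_le_semiconj: "a \<le> semiconj \<alpha>"
  using a_par by (simp add: a_par_eq_semiconj)

text \<open>A termwise limit; by \<open>semiconj_tendsto_left\<close> below, its value is the left
  limit of \<open>semiconj\<close> at \<alpha>.\<close>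

lemma a_par_right_eq:
  "a_par_right l d \<delta> \<rho> \<alpha> = \<delta> / (1 - l) +
     1 / l * (\<Sum>k. l ^ Suc k * (d - (1 - l) - stair l d (1 - \<alpha>) (real (Suc k) * \<rho> - \<alpha>)))"
  and summable_a_par_right:
  "summable (\<lambda>k. l ^ Suc k * (d - (1 - l) - stair l d (1 - \<alpha>) (real (Suc k) * \<rho> - \<alpha>)))"
proof -
  let ?b = "\<lambda>k. d - (1 - l) - stair l d (1 - \<alpha>) (real (Suc k) * \<rho> - \<alpha>)"
  have ev: "\<forall>\<^sub>F r in at_right \<rho>. stair l d \<alpha> (\<alpha> - real (Suc k) * r) = ?b k" for k
    by (rule eventually_stair_at_right) simp
  have bd: "\<forall>\<^sub>F r in at_right \<rho>. \<forall>k. \<bar>\<alpha> - real (Suc k) * r\<bar> \<le> real (Suc k) + \<bar>\<alpha>\<bar>"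
    using eventually_at_right_real[of \<rho> 1] \<rho>
    by (auto elim!: eventually_mono intro!: abs_diff_mult_le simp del: of_nat_Suc)
  show "summable (\<lambda>k. l ^ Suc k * ?b k)"
    by (rule tendsto_stair_series(1)[OF l d _ ev bd]) simp
  have "((\<lambda>r. \<Sum>k. l ^ Suc k * stair l d \<alpha> (\<alpha> - real (Suc k) * r)) \<longlongrightarrow> (\<Sum>k. l ^ Suc k * ?b k)) (at_right \<rho>)"
    by (rule tendsto_stair_series(2)[OF l d _ ev bd]) simp
  then have "((\<lambda>r. a_par l d \<delta> r \<alpha>) \<longlongrightarrow> \<delta> / (1 - l) + 1 / l * (\<Sum>k. l ^ Suc k * ?b k)) (at_right \<rho>)"
    unfolding a_par_def stair_def[symmetric] by (intro tendsto_intros) simp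
  then show "a_par_right l d \<delta> \<rho> \<alpha> = \<delta> / (1 - l) + 1 / l * (\<Sum>k. l ^ Suc k * ?b k)"
    unfolding a_par_right_def by (intro tendsto_Lim) auto
qed

text \<open>Reflection bounds \<open>semiconj\<close> at a point between \<open>y\<close> and
  \<alpha> by \<open>a_par_right\<close>; strict monotonicity makes the inequality strict.\<close>

lemma semiconj_less_a:
  assumes "y < \<alpha>"
  shows "semiconj y < a"
proof -
  obtain y' where y': "y < y'" "y' < \<alpha>"
    using dense[OF assms] by blast
  have "(\<Sum>k. l ^ Suc k * stair l d \<alpha> (y' - real (Suc k) * \<rho>))
      \<le> (\<Sum>k. l ^ Suc k * (d - (1 - l) - stair l d (1 - \<alpha>) (real (Suc k) * \<rho> - \<alpha>)))"
  proof (rule suminf_le[OF _ summable_stair summable_a_par_right])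
    fix k
    have "stair l d \<alpha> (y' - real (Suc k) * \<rho>) + stair l d (1 - \<alpha>) (real (Suc k) * \<rho> - \<alpha>) \<le> d - (1 - l)"
      using y' by (intro stair_reflect_le[OF l d]) auto
    then show "l ^ Suc k * stair l d \<alpha> (y' - real (Suc k) * \<rho>)
        \<le> l ^ Suc k * (d - (1 - l) - stair l d (1 - \<alpha>) (real (Suc k) * \<rho> - \<alpha>))"
      using l by (intro mult_left_mono) auto
  qed
  then have "semiconj y' \<le> a_par_right l d \<delta> \<rho> \<alpha>"
    unfolding a_par_right_eq semiconj_def using l by (intro add_left_mono mult_left_mono) auto
  also have "\<dots> \<le> a"
    using a_par by simp
  finally show ?thesis
    using semiconj_less_iff[of y y'] y' by linarith
qed

text \<open>For \<open>\<alpha> = 1 - \<rho>\<close> the point \<open>\<alpha>\<close> has no integer among its backward rotations, so that the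
  interval allowed for \<open>a\<close> is degenerate.\<close>

lemma a_par_right_eq_a_par:
  assumes "\<alpha> = 1 - \<rho>"
  shows "a_par_right l d \<delta> \<rho> \<alpha> = a_par l d \<delta> \<rho> \<alpha>"
proof -
  have "d - (1 - l) - stair l d (1 - \<alpha>) (real (Suc k) * \<rho> - \<alpha>) = stair l d \<alpha> (\<alpha> - real (Suc k) * \<rho>)" for k
  proof -
    \<comment> \<open>Up to integers the two arguments are \<open>?z\<close> and
      \<open>- ?z\<close>. The multiplier is at least 2, so irrationality keeps \<open>?z\<close>
      off the integers and \<open>frac ?z\<close> off \<open>\<rho>\<close>.\<close>
    let ?z = "real (Suc (Suc k)) * \<rho>"
    have z: "frac ?z \<noteq> \<rho>" "?z \<notin> \<int>"
      using frac_irrational_multiple_eq_iff[OF irrational, of "int (Suc (Suc k))" 1]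
        frac_irrational_multiple_eq_iff[OF irrational, of "int (Suc (Suc k))" 0] \<rho>
      by (auto simp: frac_eq[THEN iffD2] simp del: of_nat_Suc)
    have e: "real (Suc k) * \<rho> - \<alpha> = ?z + of_int (-1)" "\<alpha> - real (Suc k) * \<rho> = - ?z + of_int 1"
      by (simp_all add: assms algebra_simps)
    have "stair l d \<alpha> (- ?z) + stair l d (1 - \<alpha>) ?z = d - (1 - l)"
      using z assms by (intro stair_reflect_eq) auto
    then show ?thesis
      unfolding e stair_add_of_int by simp
  qed
  then show ?thesis
    unfolding a_par_right_eq a_par_def stair_def[symmetric] by simp
qed

lemma a_eq_semiconj: "\<alpha> = 1 - \<rho> \<Longrightarrow> a = semiconj \<alpha>"
  using a_par_right_eq_a_par a_par unfolding a_par_eq_semiconj by simp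

lemma of_int_le_semiconj_iff: "of_int m \<le> semiconj w \<longleftrightarrow> of_int m \<le> w"
  using semiconj_add_of_int[of w "-m"] semiconj_neg[of "w - of_int m"] semiconj_0_nonneg
    semiconj_le_iff[of 0 "w - of_int m"] by auto

lemma a_le_semiconj_iff: "a + of_int m \<le> semiconj w \<longleftrightarrow> \<alpha> + of_int m \<le> w"
  using semiconj_add_of_int[of w "-m"] semiconj_less_a[of "w - of_int m"] a_le_semiconj
    semiconj_le_iff[of \<alpha> "w - of_int m"] by auto

lemma stair_semiconj: "stair l d a (semiconj w) = stair l d \<alpha> w"
  by (rule stair_cong[OF of_int_le_semiconj_iff a_le_semiconj_iff])

text \<open>\<open>semiconj_rec\<close> has the cut \<alpha> at \<open>w\<close> where
  \<open>lift_map\<close> has the cut \<open>a\<close> at \<open>semiconj w\<close>;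
  \<open>stair_semiconj\<close> identifies the two.\<close>

lemma lift_map_semiconj: "lift_map l d \<delta> a (semiconj w) = semiconj (w + \<rho>)"
  using semiconj_rec[of "w + \<rho>"] by (simp add: lift_map_stair stair_semiconj)

lemma floor_semiconj: "\<lfloor>semiconj w\<rfloor> = \<lfloor>w\<rfloor>"
  using of_int_le_semiconj_iff[of "\<lfloor>semiconj w\<rfloor>" w] of_int_le_semiconj_iff[of "\<lfloor>w\<rfloor>" w]
  by (intro order.antisym) (simp_all add: le_floor_iff)

lemma frac_semiconj: "frac (semiconj w) = semiconj (frac w)"
  using semiconj_add_of_int[of w "- \<lfloor>w\<rfloor>"] by (simp add: frac_def floor_semiconj)

lemma semiconj_mem_unit_iff: "semiconj w \<in> {0..<1} \<longleftrightarrow> w \<in> {0..<1}"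
  using of_int_le_semiconj_iff[of 0 w] of_int_le_semiconj_iff[of 1 w] by auto

lemma contraction_semiconj: "contraction l d \<delta> a (semiconj z) = semiconj (frac (z + \<rho>))"
  by (simp add: contraction_def lift_map_semiconj frac_semiconj)

lemma contraction_funpow_semiconj:
  assumes "y \<in> {0..<1}"
  shows "(contraction l d \<delta> a ^^ n) (semiconj y) = semiconj (frac (y + real n * \<rho>))"
proof (induction n)
  case 0
  then show ?case
    using assms by (simp add: frac_eq)
next
  case (Suc n)
  have "frac (frac (y + real n * \<rho>) + \<rho>) = frac (y + real (Suc n) * \<rho>)"
    by (simp add: frac_add_frac_left algebra_simps)
  then show ?case
    using Suc by (simp add: contraction_semiconj)
qed

section \<open>Backward orbits and the attractor\<close>

lemma lift_map_strict_mono: "strict_mono (lift_map l d \<delta> a)"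
proof
  fix x y :: real
  assume "x < y"
  then have "l * x < l * y"
    using l by simp
  then show "lift_map l d \<delta> a x < lift_map l d \<delta> a y"
    using stair_mono[OF l d, of x y a] \<open>x < y\<close> by (simp add: lift_map_stair)
qed

lemma lift_map_funpow_add_of_int:
  "(lift_map l d \<delta> a ^^ n) (x + of_int m) = (lift_map l d \<delta> a ^^ n) x + of_int m"
proof (induction n)
  case (Suc n)
  have "lift_map l d \<delta> a (z + of_int m) = lift_map l d \<delta> a z + of_int m" for z
    by (simp add: lift_map_stair stair_add_of_int algebra_simps)
  with Suc show ?case
    by simp
qed simp

text \<open>The lift commutes with integer translations, so all reductions modulo 1 can be collected
  in one shift of the starting point.\<close>

lemma contraction_funpow_lift:
  "\<exists>m::int. (contraction l d \<delta> a ^^ n) x = (lift_map l d \<delta> a ^^ n) (x + of_int m)"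
proof (induction n)
  case 0
  show ?case
    by (auto intro: exI[of _ 0])
next
  case (Suc n)
  then obtain m :: int where m: "(contraction l d \<delta> a ^^ n) x = (lift_map l d \<delta> a ^^ n) (x + of_int m)"
    by blast
  define y where "y = (lift_map l d \<delta> a ^^ n) (x + of_int m)"
  have "(contraction l d \<delta> a ^^ Suc n) x = (lift_map l d \<delta> a ^^ Suc n) (x + of_int m) - of_int \<lfloor>lift_map l d \<delta> a y\<rfloor>"
    by (simp add: m contraction_def frac_def y_def)
  also have "\<dots> = (lift_map l d \<delta> a ^^ Suc n) (x + of_int (m - \<lfloor>lift_map l d \<delta> a y\<rfloor>))"
    using lift_map_funpow_add_of_int[of "Suc n" "x + of_int m" "- \<lfloor>lift_map l d \<delta> a y\<rfloor>"]
    by (simp add: algebra_simps del: funpow.simps)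
  finally show ?case
    by blast
qed

text \<open>Each iterate provides its own preimage of \<open>x\<close>; injectivity of the lift
  makes these consecutive points of one orbit.\<close>

lemma attractor_backward_orbit:
  assumes "x \<in> attractor (contraction l d \<delta> a)"
  obtains X where "X 0 = x" "\<And>n. lift_map l d \<delta> a (X (Suc n)) = X n"
proof -
  have "\<exists>z. (lift_map l d \<delta> a ^^ n) z = x" for n
  proof -
    obtain z where "x = (contraction l d \<delta> a ^^ n) z"
      using assms by (auto simp: attractor_def)
    then show ?thesis
      using contraction_funpow_lift[of n z] by metis
  qed
  then obtain X where X: "\<And>n. (lift_map l d \<delta> a ^^ n) (X n) = x"
    by metis
  have "lift_map l d \<delta> a (X (Suc n)) = X n" for n
  proof (rule injD[OF inj_fn[OF strict_mono_imp_inj_on[OF lift_map_strict_mono]]])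
    show "(lift_map l d \<delta> a ^^ n) (lift_map l d \<delta> a (X (Suc n))) = (lift_map l d \<delta> a ^^ n) (X n)"
      using X[of n] X[of "Suc n"] by (simp add: funpow_Suc_right del: funpow.simps)
  qed
  then show thesis
    using that[of X] X[of 0] by simp
qed

text \<open>A hit prescribes \<open>n * \<rho>\<close> modulo 1, and multiples of an irrational are
  distinct modulo 1.\<close>

lemma finite_rotation_hits: "finite {n. \<exists>m::int. y - real n * \<rho> = c + of_int m}"
proof (rule finite_subset)
  show "{n. \<exists>m::int. y - real n * \<rho> = c + of_int m} \<subseteq> {n. frac (of_int (int n) * \<rho>) = frac (y - c)}"
  proof clarify
    fix n and m :: int
    assume "y - real n * \<rho> = c + of_int m"
    then have "of_int (int n) * \<rho> = (y - c) - of_int m"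
      by simp
    then show "frac (of_int (int n) * \<rho>) = frac (y - c)"
      by (metis frac_diff_of_int)
  qed
  have "inj (\<lambda>n. frac (of_int (int n) * \<rho>))"
    using inj_compose[OF inj_frac_irrational_multiple[OF irrational] inj_of_nat] by (simp add: comp_def)
  then show "finite {n. frac (of_int (int n) * \<rho>) = frac (y - c)}"
    using finite_vimageI[of "{frac (y - c)}" "\<lambda>n. frac (of_int (int n) * \<rho>)"] by (simp add: vimage_def)
qed

text \<open>A backward orbit is squeezed between the left and right values of \<open>semiconj\<close> along a backward
  rotation orbit. The two itineraries can only differ when the rotation hits a partition point,
  which happens finitely often; beyond the last difference the contraction forces equality with
  \<open>semiconj\<close>, whose itinerary is the right one.\<close>

lemma attractor_subset: "attractor (contraction l d \<delta> a) \<subseteq> semiconj ` {0..<1}"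
proof
  fix x assume x: "x \<in> attractor (contraction l d \<delta> a)"
  have x01: "x \<in> {0..<1}"
    using x by (auto simp: attractor_def dest: spec[of _ 0])
  obtain X where X0: "X 0 = x" and X: "\<And>n. lift_map l d \<delta> a (X (Suc n)) = X n"
    by (rule attractor_backward_orbit[OF x]) (rule that)
  \<comment> \<open>The point where \<open>semiconj\<close> passes \<open>x\<close>; the supremum
    makes sense even if \<open>x\<close> falls into a jump.\<close>
  define y where "y = Sup {y. semiconj y \<le> x}"
  have bdd: "bdd_above {y. semiconj y \<le> x}"
  proof (rule bdd_aboveI)
    fix y assume "y \<in> {y. semiconj y \<le> x}"
    then show "y \<le> 1"
      using of_int_le_semiconj_iff[of 1 y] x01 by auto
  qed
  have ne: "{y. semiconj y \<le> x} \<noteq> {}"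
    using semiconj_neg[of "-1"] x01 by (auto intro!: exI[of _ "-1"])
  have below: "semiconj y' \<le> x" if "y' < y" for y'
  proof -
    have "\<exists>z\<in>{y. semiconj y \<le> x}. y' < z"
      using that unfolding y_def less_cSup_iff[OF ne bdd] .
    then obtain z where "semiconj z \<le> x" "y' < z"
      by blast
    then show ?thesis
      using semiconj_less_iff[of y' z] by linarith
  qed
  have above: "x < semiconj y'" if "y < y'" for y'
    using cSup_upper[OF _ bdd, of y'] that by (force simp: y_def)
  have below: "semiconj (y' - real n * \<rho>) \<le> X n" if "y' < y" for y' n
  proof (induction n)
    case 0
    then show ?case
      using below[OF that] X0 by simp
  next
    case (Suc n)
    have "lift_map l d \<delta> a (semiconj (y' - real (Suc n) * \<rho>)) = semiconj (y' - real n * \<rho>)"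
      by (simp add: lift_map_semiconj algebra_simps)
    then show ?case
      using Suc X[of n] strict_mono_less_eq[OF lift_map_strict_mono] by metis
  qed
  have above: "X n < semiconj (y' - real n * \<rho>)" if "y < y'" for y' n
  proof (induction n)
    case 0
    then show ?case
      using above[OF that] X0 by simp
  next
    case (Suc n)
    have "lift_map l d \<delta> a (semiconj (y' - real (Suc n) * \<rho>)) = semiconj (y' - real n * \<rho>)"
      by (simp add: lift_map_semiconj algebra_simps)
    then show ?case
      using Suc X[of n] strict_mono_less[OF lift_map_strict_mono] by metis
  qed
  \<comment> \<open>Comparisons with a threshold carry over from \<open>semiconj\<close> to
    \<open>X n\<close> unless \<open>y - n * \<rho>\<close> hits that threshold.\<close>
  have le_X: "c \<le> X n" if "\<And>w. c' \<le> w \<Longrightarrow> c \<le> semiconj w" "c' < y - real n * \<rho>" for c c' n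
    using that(1)[of c'] below[of "c' + real n * \<rho>" n] that(2) by simp
  have X_less: "X n < c" if "\<And>w. w < c' \<Longrightarrow> semiconj w < c" "y - real n * \<rho> < c'" for c c' n
    using dense[OF that(2)] above[of "_ + real n * \<rho>" n] that(1) by (force simp: algebra_simps)
  define good where "good n \<longleftrightarrow> (\<forall>m::int. of_int m \<le> X n \<longleftrightarrow> of_int m \<le> y - real n * \<rho>) \<and>
      (\<forall>m::int. a + of_int m \<le> X n \<longleftrightarrow> \<alpha> + of_int m \<le> y - real n * \<rho>)" for n
  have bad: "(\<exists>m::int. y - real n * \<rho> = 0 + of_int m) \<or> (\<exists>m::int. y - real n * \<rho> = \<alpha> + of_int m)"
    if "\<not> good n" for n
  proof (rule ccontr)
    assume no: "\<not> ?thesis"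
    have "of_int m \<le> X n \<longleftrightarrow> of_int m \<le> y - real n * \<rho>" for m :: int
      using le_X[of "of_int m" "of_int m" n] X_less[of "of_int m" "of_int m" n] no
        of_int_le_semiconj_iff[of m] by (force simp: not_le[symmetric])
    moreover have "a + of_int m \<le> X n \<longleftrightarrow> \<alpha> + of_int m \<le> y - real n * \<rho>" for m :: int
      using le_X[of "\<alpha> + of_int m" "a + of_int m" n] X_less[of "\<alpha> + of_int m" "a + of_int m" n] no
        a_le_semiconj_iff[of m] by (force simp: not_le[symmetric])
    ultimately show False
      using that by (auto simp: good_def)
  qed
  have "finite {n. \<not> good n}"
    by (rule finite_subset[OF _ finite_UnI[OF finite_rotation_hits[of y 0] finite_rotation_hits[of y \<alpha>]]])
      (use bad in blast)
  have eq: "X n = semiconj (y - real n * \<rho>)" if good: "\<And>j. j > n \<Longrightarrow> good j" for n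
  proof -
    define D where "D j = X j - semiconj (y - real j * \<rho>)" for j
    \<comment> \<open>Moving \<open>y\<close> by 1 either way moves \<open>semiconj\<close> by 1, so
      the squeeze bounds \<open>D\<close> uniformly; \<open>D j = l * D (Suc j)\<close> then forces
      \<open>D n = 0\<close>.\<close>
    have D_le: "\<bar>D j\<bar> \<le> 1" for j
      using below[of "y - 1" j] above[of "y + 1" j] semiconj_add_of_int[of "y - real j * \<rho>" 1]
        semiconj_add_of_int[of "y - real j * \<rho>" "-1"] by (simp add: D_def algebra_simps)
    have step: "D j = l * D (Suc j)" if "j \<ge> n" for j
    proof -
      have "stair l d a (X (Suc j)) = stair l d \<alpha> (y - real (Suc j) * \<rho>)"
        using good[of "Suc j"] that by (intro stair_cong) (auto simp: good_def)
      then show ?thesis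
        using X[of j] semiconj_rec[of "y - real j * \<rho>"]
        by (simp add: D_def lift_map_stair algebra_simps)
    qed
    have D_n: "D n = l ^ i * D (n + i)" for i
    proof (induction i)
      case (Suc i)
      have "D (n + i) = l * D (Suc (n + i))"
        by (rule step) simp
      with Suc show ?case
        by simp
    qed simp
    have "\<bar>D n\<bar> \<le> l ^ i" for i
    proof -
      have "\<bar>D n\<bar> = l ^ i * \<bar>D (n + i)\<bar>"
        using l by (subst D_n[of i]) (simp add: abs_mult)
      also have "\<dots> \<le> l ^ i * 1"
        using l D_le by (intro mult_left_mono) auto
      finally show ?thesis
        by simp
    qed
    moreover have "(\<lambda>i. l ^ i) \<longlonglongrightarrow> 0"
      using l by (intro LIMSEQ_realpow_zero) auto
    ultimately have "\<bar>D n\<bar> \<le> 0"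
      by (intro LIMSEQ_le_const) auto
    then show ?thesis
      by (simp add: D_def)
  qed
  have "{n. \<not> good n} = {}"
  proof (rule ccontr)
    assume ne: "{n. \<not> good n} \<noteq> {}"
    define n where "n = Max {n. \<not> good n}"
    have "\<not> good n"
      using Max_in[OF \<open>finite {n. \<not> good n}\<close> ne] by (simp add: n_def)
    moreover have "X n = semiconj (y - real n * \<rho>)"
      using Max_ge[OF \<open>finite {n. \<not> good n}\<close>] by (intro eq) (force simp: n_def)
    ultimately show False
      by (simp add: good_def of_int_le_semiconj_iff a_le_semiconj_iff)
  qed
  then have "x = semiconj y"
    using eq[of 0] X0 by auto
  then show "x \<in> semiconj ` {0..<1}"
    using x01 semiconj_mem_unit_iff by blast
qed

end

subsection \<open>Codings by cut points\<close>

lemma cut_partition_cong: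
  "C \<inter> {0<..<1} = C' \<inter> {0<..<1} \<Longrightarrow> cut_partition C = cut_partition C'"
  by (simp add: cut_partition_def)

lemma length_cut_partition:
  assumes "finite C"
  shows "length (cut_partition C) = Suc (card (C \<inter> {0<..<1}))"
  using assms by (simp add: cut_partition_def Let_def)

text \<open>The sorted list starts with the extra point 0, which is at most \<open>x\<close>;
  counting from index 0 therefore counts the inner cuts only.\<close>

lemma index_cut_partition:
  assumes C: "finite C" and x: "x \<in> {0..<1}"
  shows "(THE i. i < length (cut_partition C) \<and> x \<in> cut_partition C ! i)
    = card {c \<in> C \<inter> {0<..<1}. c \<le> x}" (is "_ = ?m")
proof -
  define S where "S = insert 0 (C \<inter> {0<..<1})"
  define cs where "cs = sorted_list_of_set S"
  have S: "finite S"
    using C by (simp add: S_def)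
  have set_cs: "set cs = S" and dist: "distinct cs" and sorted: "sorted cs" and len: "length cs = card S"
    using S by (auto simp: cs_def)
  have "{s \<in> S. s \<le> x} = insert 0 {c \<in> C \<inter> {0<..<1}. c \<le> x}"
    using x by (auto simp: S_def)
  then have card: "card {s \<in> S. s \<le> x} = Suc ?m"
    using C by simp
  have m_len: "?m < length cs"
    using card_mono[OF S, of "{s \<in> S. s \<le> x}"] card len by simp
  have le_iff: "cs ! j \<le> x \<longleftrightarrow> j \<le> ?m" if j: "j < length cs" for j
  proof
    assume "cs ! j \<le> x"
    then have "(!) cs ` {..j} \<subseteq> {s \<in> S. s \<le> x}"
      using j sorted_nth_mono[OF sorted _ j] set_cs by (force intro: nth_mem)
    then have "card ((!) cs ` {..j}) \<le> Suc ?m"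
      using card_mono[of "{s \<in> S. s \<le> x}"] S card by simp
    moreover have "inj_on ((!) cs) {..j}"
      using j dist by (auto intro!: inj_on_nth)
    ultimately show "j \<le> ?m"
      by (simp add: card_image)
  next
    assume "j \<le> ?m"
    show "cs ! j \<le> x"
    proof (rule ccontr)
      assume "\<not> cs ! j \<le> x"
      have "{s \<in> S. s \<le> x} \<subseteq> (!) cs ` {..<j}"
      proof clarify
        fix s assume "s \<in> S" "s \<le> x"
        then obtain i where i: "i < length cs" "s = cs ! i"
          using set_cs by (metis in_set_conv_nth)
        have "i < j"
          using sorted_nth_mono[OF sorted _ i(1), of j] i(2) \<open>s \<le> x\<close> \<open>\<not> cs ! j \<le> x\<close>
          by (metis linorder_not_less order_trans)
        then show "s \<in> (!) cs ` {..<j}"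
          using i by blast
      qed
      then have "card {s \<in> S. s \<le> x} \<le> card ((!) cs ` {..<j})"
        by (intro card_mono) simp
      also have "\<dots> \<le> j"
        using card_image_le[of "{..<j}" "(!) cs"] by simp
      finally have "Suc ?m \<le> j"
        by (simp only: card)
      with \<open>j \<le> ?m\<close> show False
        by simp
    qed
  qed
  have P: "cut_partition C = map2 (\<lambda>u v. {u..<v}) cs (tl cs @ [1])"
    by (simp add: cut_partition_def Let_def cs_def S_def)
  have lenP: "length (cut_partition C) = length cs"
    using m_len by (simp add: P)
  have mem_iff: "x \<in> cut_partition C ! j \<longleftrightarrow> j = ?m" if j: "j < length cs" for j
  proof (cases "Suc j < length cs")
    case True
    then have "cut_partition C ! j = {cs ! j..<cs ! Suc j}"
      by (simp add: P nth_append nth_tl)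
    then show ?thesis
      using le_iff[OF j] le_iff[OF True] by (auto simp: not_le[symmetric])
  next
    case False
    then have "cut_partition C ! j = {cs ! j..<1}"
      using j by (simp add: P nth_append)
    then show ?thesis
      using le_iff[OF j] x m_len False by auto
  qed
  show ?thesis
  proof (rule the_equality)
    show "?m < length (cut_partition C) \<and> x \<in> cut_partition C ! ?m"
      using mem_iff[OF m_len] m_len lenP by simp
    show "i = ?m" if "i < length (cut_partition C) \<and> x \<in> cut_partition C ! i" for i
      using mem_iff[of i] that lenP by simp
  qed
qed

text \<open>The sets of cuts passed by two points are nested, so equal cardinality means equality.
  Cuts outside the open unit interval separate no points of \<open>{0..<1}\<close>.\<close>

lemma index_cut_partition_eq_iff:
  assumes C: "finite C" and x: "x \<in> {0..<1}" "y \<in> {0..<1}"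
  shows "(THE i. i < length (cut_partition C) \<and> x \<in> cut_partition C ! i)
      = (THE i. i < length (cut_partition C) \<and> y \<in> cut_partition C ! i)
    \<longleftrightarrow> (\<forall>c\<in>C. x < c \<longleftrightarrow> y < c)"
proof -
  let ?S = "\<lambda>x. {c \<in> C \<inter> {0<..<1}. c \<le> x}"
  have fin: "finite (?S z)" for z
    using C by simp
  have "card (?S x) = card (?S y) \<longleftrightarrow> ?S x = ?S y"
  proof
    assume eq: "card (?S x) = card (?S y)"
    have "?S x \<subseteq> ?S y \<or> ?S y \<subseteq> ?S x"
      by (cases "x \<le> y") auto
    then show "?S x = ?S y"
    proof
      assume "?S x \<subseteq> ?S y"
      from card_subset_eq[OF fin this eq] show ?thesis .
    next
      assume "?S y \<subseteq> ?S x"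
      from card_subset_eq[OF fin this eq[symmetric]] show ?thesis ..
    qed
  qed simp
  also have "\<dots> \<longleftrightarrow> (\<forall>c\<in>C. x < c \<longleftrightarrow> y < c)"
  proof -
    have "(c \<in> ?S x \<longleftrightarrow> c \<in> ?S y) \<longleftrightarrow> (x < c \<longleftrightarrow> y < c)" if "c \<in> C" for c
      using that x by (auto simp: not_le)
    moreover have "?S x = ?S y \<longleftrightarrow> (\<forall>c\<in>C. c \<in> ?S x \<longleftrightarrow> c \<in> ?S y)"
      by (intro iffI ballI set_eqI) auto
    ultimately show ?thesis
      by simp
  qed
  finally show ?thesis
    unfolding index_cut_partition[OF C x(1)] index_cut_partition[OF C x(2)] .
qed

section \<open>Counting cells\<close>

lemma card_range_eq_of_same_kernel:
  assumes "\<And>x y. f x = f y \<longleftrightarrow> g x = g y"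
  shows "card (range f) = card (range g)"
proof -
  have f: "f (inv f (f x)) = f x" for x
    by (simp add: f_inv_into_f)
  then have g: "g (inv f (f x)) = g x" for x
    using assms by blast
  have "(\<lambda>v. g (inv f v)) ` range f = range g"
    by (simp add: image_image g)
  moreover have "inj_on (\<lambda>v. g (inv f v)) (range f)"
    by (auto intro!: inj_onI simp: g assms)
  ultimately show ?thesis
    by (metis card_image)
qed

text \<open>A cell is determined by its left end point, which exists since \<open>0 \<in> E\<close>,
  and density puts a point of \<open>Z\<close> inside each cell.\<close>

lemma card_cells_of_dense:
  fixes E Z :: "real set"
  assumes E: "finite E" "0 \<in> E" "E \<subseteq> {0..<1}" and Z: "Z \<subseteq> {0..<1}"
    and dense: "\<And>u v. 0 \<le> u \<Longrightarrow> u < v \<Longrightarrow> v \<le> 1 \<Longrightarrow> \<exists>z\<in>Z. u < z \<and> z < v"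
  shows "card ((\<lambda>z. {e \<in> E. e \<le> z}) ` Z) = card E"
proof -
  let ?G = "\<lambda>z. {e \<in> E. e \<le> z}"
  have "?G ` Z = ?G ` E"
  proof (intro equalityI subsetI)
    fix A assume "A \<in> ?G ` Z"
    then obtain z where z: "z \<in> Z" "A = ?G z"
      by blast
    define M where "M = Max (?G z)"
    have fin: "finite (?G z)" and ne: "?G z \<noteq> {}"
      using E(1,2) subsetD[OF Z z(1)] by (auto intro!: exI[of _ 0])
    have M: "M \<in> ?G z"
      unfolding M_def by (rule Max_in[OF fin ne])
    have le_M: "e \<le> M" if "e \<in> ?G z" for e
      unfolding M_def by (rule Max_ge[OF fin that])
    have "?G z = ?G M"
      using M le_M by (intro set_eqI iffI) auto
    then show "A \<in> ?G ` E"
      using M z(2) by blast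
  next
    fix A assume "A \<in> ?G ` E"
    then obtain e where e: "e \<in> E" "A = ?G e"
      by blast
    \<comment> \<open>The right end of the cell of \<open>e\<close>: the next point of
      \<open>E\<close>, or 1 after the last one.\<close>
    define v where "v = Min (insert 1 {e' \<in> E. e < e'})"
    have fin: "finite (insert 1 {e' \<in> E. e < e'})"
      using E by simp
    have e01: "0 \<le> e" "e < 1"
      using subsetD[OF E(3) e(1)] by auto
    have "v \<in> insert 1 {e' \<in> E. e < e'}"
      unfolding v_def by (rule Min_in[OF fin]) simp
    then have "e < v"
      using e01 by auto
    moreover have "v \<le> 1"
      unfolding v_def by (rule Min_le[OF fin]) simp
    ultimately obtain z where z: "z \<in> Z" "e < z" "z < v"
      using dense[OF e01(1), of v] by blast
    have "?G z = ?G e"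
    proof (intro equalityI subsetI)
      fix e' assume e': "e' \<in> ?G z"
      show "e' \<in> ?G e"
      proof (rule ccontr)
        assume "e' \<notin> ?G e"
        then have "v \<le> e'"
          unfolding v_def using e' by (intro Min_le[OF fin]) auto
        with e' z show False
          by simp
      qed
    qed (use z in auto)
    then show "A \<in> ?G ` Z"
      using z(1) e(2) by blast
  qed
  moreover have "inj_on ?G E"
  proof (rule inj_onI)
    fix e e' assume "e \<in> E" "e' \<in> E" "?G e = ?G e'"
    then have "e \<in> ?G e'" "e' \<in> ?G e"
      by (metis (mono_tags) mem_Collect_eq order.refl)+
    then show "e = e'"
      by simp
  qed
  ultimately show ?thesis
    by (simp add: card_image)
qed

text \<open>The points whose first \<open>n\<close> rotations reach \<open>0\<close>, \<open>1 - \<rho>\<close> or \<open>\<alpha>\<close>; since \<open>1 - \<rho>\<close> is the preimage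
  of \<open>0\<close>, it only contributes one further preimage of \<open>0\<close>.\<close>

definition rotation_cuts :: "real \<Rightarrow> real \<Rightarrow> nat \<Rightarrow> real set" where
  "rotation_cuts \<rho> \<alpha> n =
     (\<lambda>i::int. frac (of_int i * \<rho>)) ` {- int n..0} \<union>
     (\<lambda>i::int. frac (\<alpha> + of_int i * \<rho>)) ` {- int n + 1..0}"

section \<open>Words of the rotation and the number of cuts\<close>

text \<open>On the unit interval the floor of \<open>x - w\<close> takes at most two values and
  switches at \<open>frac w\<close>.\<close>

lemma less_frac_cong_iff:
  fixes z z' w :: real
  assumes "z \<in> {0..<1}" "z' \<in> {0..<1}"
  shows "(z < frac w \<longleftrightarrow> z' < frac w) \<longleftrightarrow> \<lfloor>z - w\<rfloor> = \<lfloor>z' - w\<rfloor>"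
proof -
  have "\<lfloor>x - w\<rfloor> = (if x < frac w then - 1 else 0) - \<lfloor>w\<rfloor>" if "x \<in> {0..<1}" for x
  proof -
    have "x - w = (x - frac w) - of_int \<lfloor>w\<rfloor>"
      by (simp add: frac_def)
    then have "\<lfloor>x - w\<rfloor> = \<lfloor>x - frac w\<rfloor> - \<lfloor>w\<rfloor>"
      by (metis floor_diff_of_int)
    moreover have "\<lfloor>x\<rfloor> = 0" "frac x = x"
      using that by (auto simp: floor_eq_iff frac_eq)
    ultimately show ?thesis
      using floor_diff_unit_interval[of "frac w" x] by (simp add: less_imp_le[OF frac_lt_1])
  qed
  then show ?thesis
    using assms by auto
qed

lemma frac_less_cong_iff:
  fixes q q' c :: real
  assumes "0 \<le> c" "c \<le> 1" "\<lfloor>q\<rfloor> = \<lfloor>q'\<rfloor>"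
  shows "(frac q < c \<longleftrightarrow> frac q' < c) \<longleftrightarrow> \<lfloor>q - c\<rfloor> = \<lfloor>q' - c\<rfloor>"
  using assms by (auto simp: floor_diff_unit_interval)

text \<open>The cut at \<open>1 - \<rho>\<close> reads off the increments of \<open>\<lfloor>z + j\<rho>\<rfloor>\<close>, so that a word determines these
  integer parts, and conversely.\<close>

lemma rotation_word_eq_iff:
  assumes \<rho>: "\<rho> \<in> {0<..<1}" and \<alpha>: "\<alpha> \<in> {0..1}" and z: "z \<in> {0..<1}" "z' \<in> {0..<1}"
  shows "(\<forall>j<n. \<forall>c\<in>{\<alpha>, 1 - \<rho>}. frac (z + real j * \<rho>) < c \<longleftrightarrow> frac (z' + real j * \<rho>) < c)
    \<longleftrightarrow> (\<forall>e\<in>rotation_cuts \<rho> \<alpha> n. z < e \<longleftrightarrow> z' < e)"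
proof -
  let ?q = "\<lambda>z j. z + real j * \<rho>"
  have "(\<forall>j<n. \<forall>c\<in>{\<alpha>, 1 - \<rho>}. frac (?q z j) < c \<longleftrightarrow> frac (?q z' j) < c)
      \<longleftrightarrow> (\<forall>j\<le>n. \<lfloor>?q z j\<rfloor> = \<lfloor>?q z' j\<rfloor>) \<and> (\<forall>j<n. \<lfloor>?q z j - \<alpha>\<rfloor> = \<lfloor>?q z' j - \<alpha>\<rfloor>)"
  proof (induction n)
    case 0
    have "\<lfloor>z\<rfloor> = 0" "\<lfloor>z'\<rfloor> = 0"
      using z by (auto simp: floor_eq_iff)
    then show ?case
      by simp
  next
    case (Suc n)
    have "(\<forall>c\<in>{\<alpha>, 1 - \<rho>}. frac (?q z n) < c \<longleftrightarrow> frac (?q z' n) < c)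
        \<longleftrightarrow> \<lfloor>?q z (Suc n)\<rfloor> = \<lfloor>?q z' (Suc n)\<rfloor> \<and> \<lfloor>?q z n - \<alpha>\<rfloor> = \<lfloor>?q z' n - \<alpha>\<rfloor>"
      if eq: "\<lfloor>?q z n\<rfloor> = \<lfloor>?q z' n\<rfloor>"
    proof -
      have "\<lfloor>?q x n - (1 - \<rho>)\<rfloor> = \<lfloor>?q x (Suc n)\<rfloor> - 1" for x
        by (simp add: algebra_simps flip: floor_diff_one)
      then show ?thesis
        using frac_less_cong_iff[OF _ _ eq, of \<alpha>] frac_less_cong_iff[OF _ _ eq, of "1 - \<rho>"] \<rho> \<alpha>
        by auto
    qed
    then show ?case
      using Suc by (auto simp: less_Suc_eq le_Suc_eq)
  qed
  also have "(\<forall>j\<le>n. \<lfloor>?q z j\<rfloor> = \<lfloor>?q z' j\<rfloor>) \<longleftrightarrow>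
      (\<forall>i\<in>{- int n..0}. z < frac (of_int i * \<rho>) \<longleftrightarrow> z' < frac (of_int i * \<rho>))"
  proof -
    \<comment> \<open>The floors are those of \<open>z - w\<close> with
      \<open>w = - j * \<rho>\<close>, hence the non-positive indices.\<close>
    have "{- int n..0} = (\<lambda>j. - int j) ` {..n}"
      by (auto intro!: image_eqI[of _ _ "nat (- _)"])
    then show ?thesis
      unfolding less_frac_cong_iff[OF z] by auto
  qed
  also have "(\<forall>j<n. \<lfloor>?q z j - \<alpha>\<rfloor> = \<lfloor>?q z' j - \<alpha>\<rfloor>) \<longleftrightarrow>
      (\<forall>i\<in>{- int n + 1..0}. z < frac (\<alpha> + of_int i * \<rho>) \<longleftrightarrow> z' < frac (\<alpha> + of_int i * \<rho>))"
  proof -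
    have "{- int n + 1..0} = (\<lambda>j. - int j) ` {..<n}"
      by (auto intro!: image_eqI[of _ _ "nat (- _)"])
    then show ?thesis
      unfolding less_frac_cong_iff[OF z] by (auto simp: algebra_simps)
  qed
  finally show ?thesis
    by (auto simp: rotation_cuts_def)
qed

text \<open>The backward orbits of 0 and \<alpha> contribute \<open>n + 1\<close> and
  \<open>n\<close> distinct points; a common point would put \<alpha> on the orbit of 0 modulo
  1.\<close>

lemma card_rotation_cuts_generic:
  assumes \<rho>: "\<rho> \<notin> \<rat>" and \<alpha>: "\<And>k::int. frac \<alpha> \<noteq> frac (of_int k * \<rho>)"
  shows "card (rotation_cuts \<rho> \<alpha> n) = 2 * n + 1"
proof -
  have "inj_on (\<lambda>i::int. frac (\<alpha> + of_int i * \<rho>)) A" for A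
  proof (rule inj_onI)
    fix i j :: int
    assume "frac (\<alpha> + of_int i * \<rho>) = frac (\<alpha> + of_int j * \<rho>)"
    then have "frac (frac (\<alpha> + of_int i * \<rho>) + - \<alpha>) = frac (frac (\<alpha> + of_int j * \<rho>) + - \<alpha>)"
      by simp
    then show "i = j"
      unfolding frac_add_frac_left by (simp add: frac_irrational_multiple_eq_iff[OF \<rho>])
  qed
  then have "card ((\<lambda>i::int. frac (\<alpha> + of_int i * \<rho>)) ` {- int n + 1..0}) = n"
    by (simp add: card_image)
  moreover have "card ((\<lambda>i::int. frac (of_int i * \<rho>)) ` {- int n..0}) = n + 1"
    by (simp add: card_image[OF inj_frac_irrational_multiple[OF \<rho>]])
  moreover have "(\<lambda>i::int. frac (of_int i * \<rho>)) ` {- int n..0} \<inter>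
      (\<lambda>i::int. frac (\<alpha> + of_int i * \<rho>)) ` {- int n + 1..0} = {}"
  proof (rule ccontr)
    assume "\<not> ?thesis"
    then obtain i j :: int where "frac (of_int i * \<rho>) = frac (\<alpha> + of_int j * \<rho>)"
      by auto
    then have "frac (frac (of_int i * \<rho>) + of_int (- j) * \<rho>) = frac (frac (\<alpha> + of_int j * \<rho>) + of_int (- j) * \<rho>)"
      by simp
    then have "frac \<alpha> = frac (of_int (i - j) * \<rho>)"
      unfolding frac_add_frac_left by (simp add: algebra_simps)
    with \<alpha> show False
      by blast
  qed
  ultimately show ?thesis
    unfolding rotation_cuts_def by (subst card_Un_disjoint) auto
qed

text \<open>All cuts lie on the orbit of 0, with indices from \<open>- n\<close> to \<open>0\<close>
  and from \<open>k - n + 1\<close> to \<open>k\<close>. The lower bound on \<open>n\<close> ensures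
  that these two blocks leave no gap.\<close>

lemma card_rotation_cuts_resonant:
  assumes \<rho>: "\<rho> \<notin> \<rat>" and \<alpha>: "frac \<alpha> = frac (of_int k * \<rho>)"
    and n: "n \<ge> max 1 (complexity_offset k - 1)"
  shows "card (rotation_cuts \<rho> \<alpha> n) = n + complexity_offset k"
proof -
  have "frac (\<alpha> + of_int i * \<rho>) = frac (of_int (k + i) * \<rho>)" for i :: int
    using arg_cong[OF \<alpha>, of "\<lambda>x. frac (x + of_int i * \<rho>)"]
    unfolding frac_add_frac_left by (simp add: algebra_simps)
  then have "(\<lambda>i::int. frac (\<alpha> + of_int i * \<rho>)) ` {- int n + 1..0}
      = (\<lambda>i::int. frac (of_int i * \<rho>)) ` (+) k ` {- int n + 1..0}"
    by (simp only: image_image)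
  also have "(+) k ` {- int n + 1..0} = {k - int n + 1..k}"
    by (simp add: algebra_simps)
  finally have "rotation_cuts \<rho> \<alpha> n = (\<lambda>i::int. frac (of_int i * \<rho>)) ` ({- int n..0} \<union> {k - int n + 1..k})"
    by (simp only: rotation_cuts_def image_Un)
  then have "card (rotation_cuts \<rho> \<alpha> n) = card ({- int n..0} \<union> {k - int n + 1..k})"
    by (simp add: card_image[OF inj_frac_irrational_multiple[OF \<rho>]])
  also have "card ({- int n..0} \<union> {k - int n + 1..k}) = n + complexity_offset k"
  proof -
    consider "k \<le> -2" | "k = -1 \<or> k = 0" | "k \<ge> 1"
      by linarith
    then show ?thesis
    proof cases
      case 1
      then have "complexity_offset k = nat (- k)" "int n \<ge> - k - 1"
        using n by (auto simp: complexity_offset_def)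
      moreover from this have "{- int n..0} \<union> {k - int n + 1..k} = {k - int n + 1..0}"
        using 1 by (intro set_eqI) (simp only: Un_iff atLeastAtMost_iff, linarith)
      ultimately show ?thesis
        using 1 by simp
    next
      case 2
      then have "complexity_offset k = 1"
        by (auto simp: complexity_offset_def)
      moreover have "{- int n..0} \<union> {k - int n + 1..k} = {- int n..0}"
        using 2 by (intro set_eqI) (simp only: Un_iff atLeastAtMost_iff, linarith)
      ultimately show ?thesis
        by simp
    next
      case 3
      then have "complexity_offset k = nat (k + 1)" "int n \<ge> k"
        using n by (auto simp: complexity_offset_def)
      moreover from this have "{- int n..0} \<union> {k - int n + 1..k} = {- int n..k}"
        using 3 by (intro set_eqI) (simp only: Un_iff atLeastAtMost_iff, linarith)
      ultimately show ?thesis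
        using 3 by simp
    qed
  qed
  finally show ?thesis .
qed

subsection \<open>Discontinuities and complexity\<close>

text \<open>At a point of continuity the difference tends to 0. All branches of the contraction have
  slope \<open>l\<close>, so removing the linear term leaves just the jump.\<close>

lemma not_isCont_of_left_gap:
  fixes f :: "real \<Rightarrow> real"
  assumes "\<epsilon> > 0" and gap: "\<forall>\<^sub>F x in at_left x0. \<epsilon> \<le> \<bar>f x0 - f x - l * (x0 - x)\<bar>"
  shows "\<not> isCont f x0"
proof
  assume "isCont f x0"
  then have "(f \<longlongrightarrow> f x0) (at_left x0)"
    by (auto simp: isCont_def intro: filterlim_mono at_le)
  then have "((\<lambda>x. \<bar>f x0 - f x - l * (x0 - x)\<bar>) \<longlongrightarrow> \<bar>f x0 - f x0 - l * (x0 - x0)\<bar>) (at_left x0)"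
    by (intro tendsto_intros)
  then have "\<forall>\<^sub>F x in at_left x0. \<bar>f x0 - f x - l * (x0 - x)\<bar> < \<epsilon>"
    using \<open>\<epsilon> > 0\<close> by (intro order_tendstoD) auto
  with gap have "\<forall>\<^sub>F x in at_left x0. False"
    by eventually_elim simp
  then show False
    by simp
qed

context quasiperiodic_contraction
begin

abbreviation \<eta> :: real where
  "\<eta> \<equiv> eta l d \<delta> a \<rho> \<alpha>"

abbreviation f :: "real \<Rightarrow> real" where
  "f \<equiv> contraction l d \<delta> a"

lemma lift_map_unit: "x \<in> {0..<1} \<Longrightarrow> lift_map l d \<delta> a x = l * x + \<delta> + (if x < a then 0 else d)"
  by (auto simp: lift_map_def theta_def frac_eq floor_eq_iff)

lemma semiconj_less_a_iff: "semiconj z < a \<longleftrightarrow> z < \<alpha>"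
  using a_le_semiconj_iff[of 0 z] by auto

lemma semiconj_less_1_iff: "semiconj z < 1 \<longleftrightarrow> z < 1"
  using of_int_le_semiconj_iff[of 1 z] by auto

lemma semiconj_add_rotation:
  assumes "z \<in> {0..<1}"
  shows "semiconj (z + \<rho>) = l * semiconj z + \<delta> + (if z < \<alpha> then 0 else d)"
  using lift_map_unit[of "semiconj z"] assms semiconj_mem_unit_iff[of z]
  by (simp add: lift_map_semiconj semiconj_less_a_iff)

text \<open>Outside the middle case \<eta> is where the lift reaches 1. The bound
  \<open>semiconj (\<alpha> + \<rho>) < 1\<close> puts it on the branch right of \<open>a\<close>,
  and \<open>1 \<le> semiconj 1\<close> on the branch left of \<open>a\<close>.\<close>

lemma
  shows eta_low: "\<alpha> < 1 - \<rho> \<Longrightarrow> l * \<eta> + \<delta> + d = 1 \<and> a < \<eta> \<and> \<eta> < 1"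
    and eta_mid: "\<alpha> = 1 - \<rho> \<Longrightarrow> \<eta> = a \<and> 0 < a \<and> a < 1"
    and eta_high: "\<alpha> > 1 - \<rho> \<Longrightarrow> l * \<eta> + \<delta> = 1 \<and> 0 < \<eta> \<and> \<eta> \<le> semiconj (1 - \<rho>) \<and> \<eta> < a"
proof -
  assume \<alpha>_less: "\<alpha> < 1 - \<rho>"
  have eq: "l * \<eta> + \<delta> + d = 1"
    using \<alpha>_less l by (simp add: eta_def)
  have "l * semiconj \<alpha> + \<delta> + d < 1"
    using semiconj_add_rotation[of \<alpha>] semiconj_less_1_iff[of "\<alpha> + \<rho>"] \<alpha> \<rho> \<alpha>_less by simp
  then have "l * semiconj \<alpha> < l * \<eta>"
    using eq by simp
  then have "a < \<eta>"
    using l a_le_semiconj by simp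
  moreover have "l * \<eta> < l * 1"
    using eq \<delta> by simp
  then have "\<eta> < 1"
    using l by (simp only: mult_less_cancel_left_pos greaterThanLessThan_iff)
  ultimately show "l * \<eta> + \<delta> + d = 1 \<and> a < \<eta> \<and> \<eta> < 1"
    using eq by simp
next
  assume \<alpha>_eq: "\<alpha> = 1 - \<rho>"
  then show "\<eta> = a \<and> 0 < a \<and> a < 1"
    using semiconj_less_a[of 0] semiconj_0_nonneg a_le_semiconj semiconj_less_1_iff[of \<alpha>] \<rho>
    by (simp add: eta_def)
next
  assume \<alpha>_gr: "\<alpha> > 1 - \<rho>"
  have eq: "l * \<eta> + \<delta> = 1"
    using \<alpha>_gr l by (simp add: eta_def)
  have "1 \<le> l * semiconj (1 - \<rho>) + \<delta>"
    using semiconj_add_rotation[of "1 - \<rho>"] semiconj_less_1_iff[of 1] \<rho> \<alpha>_gr by simp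
  then have "l * \<eta> \<le> l * semiconj (1 - \<rho>)"
    using eq by simp
  then have le: "\<eta> \<le> semiconj (1 - \<rho>)"
    using l by simp
  moreover have "0 < l * \<eta>"
    using eq \<delta> by simp
  then have "0 < \<eta>"
    using l by (simp add: zero_less_mult_iff)
  ultimately show "l * \<eta> + \<delta> = 1 \<and> 0 < \<eta> \<and> \<eta> \<le> semiconj (1 - \<rho>) \<and> \<eta> < a"
    using eq semiconj_less_a[OF \<alpha>_gr] by simp
qed

lemma eta_unit: "\<eta> \<in> {0<..<1}"
  using eta_low eta_mid eta_high a by (cases \<alpha> "1 - \<rho>" rule: linorder_cases) auto

text \<open>On the branch of \<eta>, being left of \<eta> means that the lift, which is
  \<open>semiconj (z + \<rho>)\<close>, is still below 1. On the other branch the order of \<alpha>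
  and \<open>1 - \<rho>\<close> decides both sides.\<close>

lemma semiconj_less_eta_iff:
  assumes z: "z \<in> {0..<1}"
  shows "semiconj z < \<eta> \<longleftrightarrow> z < 1 - \<rho>"
proof (cases \<alpha> "1 - \<rho>" rule: linorder_cases)
  case less
  show ?thesis
  proof (cases "z < \<alpha>")
    case True
    then show ?thesis
      using eta_low[OF less] semiconj_less_a[of z] less by simp
  next
    case False
    then have "semiconj (z + \<rho>) = l * semiconj z + \<delta> + d"
      using semiconj_add_rotation[OF z] by simp
    then have "l * semiconj z < l * \<eta> \<longleftrightarrow> semiconj (z + \<rho>) < 1"
      using eta_low[OF less] by (intro iffI) linarith+
    then have "semiconj z < \<eta> \<longleftrightarrow> semiconj (z + \<rho>) < 1"
      using l by simp
    then show ?thesis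
      using semiconj_less_1_iff[of "z + \<rho>"] by auto
  qed
next
  case equal
  then show ?thesis
    using eta_mid semiconj_less_a_iff[of z] by simp
next
  case greater
  show ?thesis
  proof (cases "z < \<alpha>")
    case True
    then have "semiconj (z + \<rho>) = l * semiconj z + \<delta>"
      using semiconj_add_rotation[OF z] by simp
    then have "l * semiconj z < l * \<eta> \<longleftrightarrow> semiconj (z + \<rho>) < 1"
      using eta_high[OF greater] by (intro iffI) linarith+
    then have "semiconj z < \<eta> \<longleftrightarrow> semiconj (z + \<rho>) < 1"
      using l by simp
    then show ?thesis
      using semiconj_less_1_iff[of "z + \<rho>"] by auto
  next
    case False
    then have "1 - \<rho> < z"
      using greater by simp
    then show ?thesis
      using eta_high[OF greater] semiconj_less_iff[of "1 - \<rho>" z] by linarith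
  qed
qed

text \<open>Lowering \<open>y\<close> moves the arguments \<open>y - k * \<rho>\<close> down just as
  raising the rotation number does, so the terms have the limits found for
  \<open>a_par_right\<close>.\<close>

lemma semiconj_tendsto_left: "(semiconj \<longlongrightarrow> a_par_right l d \<delta> \<rho> \<alpha>) (at_left \<alpha>)"
proof -
  let ?b = "\<lambda>k. d - (1 - l) - stair l d (1 - \<alpha>) (real (Suc k) * \<rho> - \<alpha>)"
  have "((\<lambda>y. \<Sum>k. l ^ Suc k * stair l d \<alpha> (y - real (Suc k) * \<rho>)) \<longlongrightarrow> (\<Sum>k. l ^ Suc k * ?b k)) (at_left \<alpha>)"
  proof (rule tendsto_stair_series(2)[OF l d])
    show "\<forall>\<^sub>F y in at_left \<alpha>. stair l d \<alpha> (y - real (Suc k) * \<rho>) = ?b k" for k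
    proof -
      let ?w = "\<alpha> - real (Suc k) * \<rho>"
      obtain t where t: "t < ?w"
        "\<And>s. t < s \<Longrightarrow> s < ?w \<Longrightarrow> stair l d \<alpha> s = d - (1 - l) - stair l d (1 - \<alpha>) (- ?w)"
        by (rule stair_left_limit[of ?w l d \<alpha>]) blast
      show ?thesis
        unfolding eventually_at_left_field
      proof (intro exI[of _ "t + real (Suc k) * \<rho>"] conjI allI impI)
        show "t + real (Suc k) * \<rho> < \<alpha>"
          using t(1) by simp
        fix y assume "t + real (Suc k) * \<rho> < y" "y < \<alpha>"
        then show "stair l d \<alpha> (y - real (Suc k) * \<rho>) = ?b k"
          using t(2)[of "y - real (Suc k) * \<rho>"] by simp
      qed
    qed
    have "\<forall>\<^sub>F y in at_left \<alpha>. y \<in> {-1<..<\<alpha>}"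
      using \<alpha> by (intro eventually_at_left_real) simp
    then show "\<forall>\<^sub>F y in at_left \<alpha>. \<forall>k. \<bar>y - real (Suc k) * \<rho>\<bar> \<le> real (Suc k) + 1"
    proof eventually_elim
      case (elim y)
      then have "\<bar>y\<bar> \<le> 1"
        using \<alpha> by auto
      then show ?case
        using add_left_mono order_trans[OF abs_diff_mult_le[OF \<rho>, of y]] by blast
    qed
  qed simp
  then show ?thesis
    unfolding a_par_right_eq semiconj_def[abs_def] by (intro tendsto_intros)
qed

text \<open>Here \<open>a\<close> is both the value and the left limit of \<open>semiconj\<close> at
  \<alpha>, and the rotation takes \<alpha> to 1. Hence the jump of the lift at \<open>a\<close>
  straddles 1.\<close>

lemma lift_at_a_mid:
  assumes \<alpha>_eq: "\<alpha> = 1 - \<rho>"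
  shows "l * a + \<delta> \<le> 1" "1 \<le> l * a + \<delta> + d"
proof -
  have "a_par_right l d \<delta> \<rho> \<alpha> = a"
    using a_par a_eq_semiconj[OF \<alpha>_eq] a_par_right_eq_a_par[OF \<alpha>_eq] by simp
  then have "((\<lambda>z. l * semiconj z + \<delta>) \<longlongrightarrow> l * a + \<delta>) (at_left \<alpha>)"
    using semiconj_tendsto_left by (auto intro!: tendsto_intros)
  moreover have "\<forall>\<^sub>F z in at_left \<alpha>. z \<in> {0<..<\<alpha>}"
    using \<rho> by (intro eventually_at_left_real) (simp add: \<alpha>_eq)
  then have "\<forall>\<^sub>F z in at_left \<alpha>. l * semiconj z + \<delta> \<le> 1"
  proof eventually_elim
    case (elim z)
    then show ?case
      using semiconj_add_rotation[of z] semiconj_less_1_iff[of "z + \<rho>"] \<rho> \<alpha>_eq by auto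
  qed
  ultimately show "l * a + \<delta> \<le> 1"
    by (intro tendsto_upperbound) auto
  show "1 \<le> l * a + \<delta> + d"
    using semiconj_add_rotation[of \<alpha>] semiconj_less_1_iff[of "\<alpha> + \<rho>"] a_eq_semiconj[OF \<alpha>_eq] \<rho> \<alpha>_eq
    by simp
qed

text \<open>The lift increases strictly and passes 1 at \<eta>, in the middle case within its jump
  at \<open>a\<close>.\<close>

lemma lift_map_ne_1:
  assumes x: "x \<in> {0..<1}" "x \<noteq> a" "x \<noteq> \<eta>"
  shows "lift_map l d \<delta> a x \<noteq> 1"
proof (cases \<alpha> "1 - \<rho>" rule: linorder_cases)
  case less
  have "l * x < l * a" if "x < a"
    using that l by simp
  moreover have "l * a < l * \<eta>"
    using eta_low[OF less] l by simp
  moreover have "l * x + \<delta> + d \<noteq> 1"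
  proof
    assume "l * x + \<delta> + d = 1"
    then have "l * x = l * \<eta>"
      using eta_low[OF less] by linarith
    then show False
      using l x(3) by simp
  qed
  ultimately show ?thesis
    using eta_low[OF less] d unfolding lift_map_unit[OF x(1)] by auto
next
  case equal
  have "l * x < l * a" if "x < a"
    using that l by simp
  moreover have "l * a < l * x" if "\<not> x < a"
    using that l x(2) by simp
  ultimately show ?thesis
    using lift_at_a_mid[OF equal] unfolding lift_map_unit[OF x(1)] by fastforce
next
  case greater
  have "l * a \<le> l * x" if "\<not> x < a"
    using that l by simp
  moreover have "l * \<eta> < l * a"
    using eta_high[OF greater] l by simp
  moreover have "l * x + \<delta> \<noteq> 1"
  proof
    assume "l * x + \<delta> = 1"
    then have "l * x = l * \<eta>"
      using eta_high[OF greater] by linarith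
    then show False
      using l x(3) by simp
  qed
  ultimately show ?thesis
    using eta_high[OF greater] d unfolding lift_map_unit[OF x(1)] by auto
qed

text \<open>This leaves 1 as the only integer value, hence the only one at which \<open>frac\<close>
  can break.\<close>

lemma lift_map_unit_bounds:
  assumes x: "x \<in> {0..<1}"
  shows "0 < lift_map l d \<delta> a x" "lift_map l d \<delta> a x < 2"
proof -
  have "0 \<le> l * x" "l * x < l"
    using l x by auto
  then show "0 < lift_map l d \<delta> a x" "lift_map l d \<delta> a x < 2"
    using l d \<delta> unfolding lift_map_unit[OF x] by auto
qed

section \<open>Discontinuities of the contraction\<close>

lemma isCont_contraction:
  assumes x: "x \<in> {0<..<1}" "x \<noteq> a" "x \<noteq> \<eta>"
  shows "isCont f x"
proof -
  have x01: "x \<in> {0..<1}"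
    using x by simp
  define c where "c = (if x < a then 0 else d)"
  have "\<forall>\<^sub>F y in nhds x. y \<in> {0<..<1}"
    using x(1) by (intro eventually_nhds_in_open) auto
  moreover have "\<forall>\<^sub>F y in nhds x. (y < a) = (x < a)"
  proof (cases "x < a")
    case True
    then have "\<forall>\<^sub>F y in nhds x. y \<in> {..<a}"
      by (intro eventually_nhds_in_open) auto
    then show ?thesis
      using True by (auto elim: eventually_mono)
  next
    case False
    then have "\<forall>\<^sub>F y in nhds x. y \<in> {a<..}"
      using x(2) by (intro eventually_nhds_in_open) auto
    then show ?thesis
      using False by (auto elim: eventually_mono)
  qed
  ultimately have "\<forall>\<^sub>F y in nhds x. lift_map l d \<delta> a y = l * y + \<delta> + c"
    by eventually_elim (simp add: lift_map_unit c_def)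
  then have "isCont (lift_map l d \<delta> a) x \<longleftrightarrow> isCont (\<lambda>y. l * y + \<delta> + c) x"
    by (rule isCont_cong)
  then have "isCont (lift_map l d \<delta> a) x"
    by simp
  moreover have "lift_map l d \<delta> a x \<notin> \<int>"
  proof
    assume "lift_map l d \<delta> a x \<in> \<int>"
    then obtain m :: int where "lift_map l d \<delta> a x = of_int m"
      by (auto elim: Ints_cases)
    moreover from this have "m = 1"
      using lift_map_unit_bounds[OF x01] by simp
    ultimately show False
      using lift_map_ne_1[OF x01 x(2,3)] by simp
  qed
  ultimately show ?thesis
    unfolding contraction_def[abs_def] by (intro isCont_o2[OF _ continuous_frac])
qed

text \<open>The lift jumps by \<open>d\<close>, and \<open>min d (1 - d)\<close> is the distance
  from \<open>d\<close> to the integers, so the jump survives modulo 1.\<close>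

lemma not_isCont_at_a:
  assumes "0 < a" "a < 1"
  shows "\<not> isCont f a"
proof (rule not_isCont_of_left_gap)
  show "0 < min d (1 - d)"
    using d l by auto
  have "\<forall>\<^sub>F x in at_left a. x \<in> {0<..<a}"
    using assms by (intro eventually_at_left_real)
  then show "\<forall>\<^sub>F x in at_left a. min d (1 - d) \<le> \<bar>f a - f x - l * (a - x)\<bar>"
  proof eventually_elim
    case (elim x)
    define m where "m = \<lfloor>lift_map l d \<delta> a a\<rfloor> - \<lfloor>lift_map l d \<delta> a x\<rfloor>"
    have "f a - f x - l * (a - x) = d - of_int m"
      using elim assms by (simp add: contraction_def frac_def m_def lift_map_unit algebra_simps)
    moreover have "m \<le> 0 \<or> 1 \<le> m"
      by linarith
    then have "min d (1 - d) \<le> \<bar>d - of_int m\<bar>"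
    proof
      assume "m \<le> 0"
      then have "of_int m \<le> (0 :: real)"
        by simp
      then show ?thesis
        by linarith
    next
      assume "1 \<le> m"
      then have "(1 :: real) \<le> of_int m"
        by simp
      then show ?thesis
        by linarith
    qed
    ultimately show ?case
      by simp
  qed
qed

lemma not_isCont_at_eta:
  assumes "\<eta> \<noteq> a"
  shows "\<not> isCont f \<eta>"
proof (rule not_isCont_of_left_gap)
  have "\<alpha> \<noteq> 1 - \<rho>"
    using eta_mid assms by auto
  then have eta: "lift_map l d \<delta> a \<eta> = 1"
    using eta_low eta_high eta_unit by (auto simp: lift_map_unit neq_iff)
  \<comment> \<open>Chosen so that \<open>{u<..<\<eta>}\<close> stays on the branch of \<eta>. There
    \<open>f\<close> rises towards 1, and it drops to 0 at \<eta>.\<close>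
  define u where "u = (if a < \<eta> then a else 0)"
  have "\<forall>\<^sub>F x in at_left \<eta>. x \<in> {u<..<\<eta>}"
    using eta_unit by (intro eventually_at_left_real) (auto simp: u_def)
  then show "\<forall>\<^sub>F x in at_left \<eta>. 1 \<le> \<bar>f \<eta> - f x - l * (\<eta> - x)\<bar>"
  proof eventually_elim
    case (elim x)
    have x01: "x \<in> {0..<1}"
      using elim eta_unit a by (auto simp: u_def split: if_splits)
    have lx: "lift_map l d \<delta> a x = 1 - l * (\<eta> - x)"
      using elim eta eta_unit x01 assms
      by (auto simp: lift_map_unit u_def algebra_simps split: if_splits)
    moreover have "0 < l * (\<eta> - x)"
      using elim l by simp
    ultimately have "f x = 1 - l * (\<eta> - x)"
      using lift_map_unit_bounds[OF x01] by (simp add: contraction_def frac_eq)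
    then show ?case
      using eta by (simp add: contraction_def)
  qed
qed simp

text \<open>Interior points are the ones that \<open>cut_partition\<close> keeps, and there
  continuity within \<open>{0..<1}\<close> is ordinary continuity.\<close>

lemma discontinuities_inner:
  "discontinuities f \<inter> {0<..<1} = {a, \<eta>} \<inter> {0<..<1}"
proof -
  have "continuous (at y within {0..<1}) f \<longleftrightarrow> y \<noteq> a \<and> y \<noteq> \<eta>" if y: "y \<in> {0<..<1}" for y
  proof -
    have "at y within {0..<1} = at y"
      using y by (intro at_within_open_subset[of _ "{0<..<1}"]) auto
    moreover have "\<not> isCont f \<eta>"
      using not_isCont_at_a not_isCont_at_eta eta_unit by (cases "\<eta> = a") auto
    ultimately show ?thesis
      using isCont_contraction[OF y] not_isCont_at_a y by auto
  qed
  then show ?thesis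
    by (auto simp: discontinuities_def)
qed

section \<open>Complexity of the code\<close>

lemma rotation_orbit_dense:
  assumes "0 \<le> u" "u < v" "v \<le> 1"
  shows "\<exists>z\<in>range (\<lambda>t. frac (y + real t * \<rho>)). u < z \<and> z < v"
proof -
  obtain k m where km: "u - y < real_of_int m + real k * \<rho>" "real_of_int m + real k * \<rho> < v - y"
    by (rule irrational_multiple_between[OF irrational, of "u - y" "v - y"]) (use assms in auto)
  have "frac (y + real k * \<rho>) = frac (y + real k * \<rho> + of_int m)"
    by simp
  also have "\<dots> = y + real k * \<rho> + of_int m"
    using km assms by (intro frac_eq[THEN iffD2]) auto
  finally have "u < frac (y + real k * \<rho>) \<and> frac (y + real k * \<rho>) < v"
    using km by simp
  then show ?thesis
    by blast
qed

text \<open>Two words agree iff their rotation points lie in the same cell of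
  \<open>rotation_cuts\<close>, and the dense orbit visits every cell.\<close>

lemma complexity_orbit_code:
  assumes x: "x \<in> attractor f"
  shows "complexity (orbit_code f (cut_partition {a, \<eta>}) x) n = card (rotation_cuts \<rho> \<alpha> n)"
proof -
  obtain y where y: "y \<in> {0..<1}" and xy: "x = semiconj y"
    using attractor_subset x by blast
  let ?s = "orbit_code f (cut_partition {a, \<eta>}) x"
  define z where "z t = frac (y + real t * \<rho>)" for t
  have z01: "z t \<in> {0..<1}" for t
    by (simp add: z_def frac_lt_1)
  have "?s i = ?s j \<longleftrightarrow> (\<forall>c\<in>{\<alpha>, 1 - \<rho>}. z i < c \<longleftrightarrow> z j < c)" for i j
  proof -
    have "semiconj (z t) \<in> {0..<1}" for t
      using z01 semiconj_mem_unit_iff by blast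
    then have "?s i = ?s j \<longleftrightarrow> (\<forall>c\<in>{a, \<eta>}. semiconj (z i) < c \<longleftrightarrow> semiconj (z j) < c)"
      unfolding orbit_code_def xy contraction_funpow_semiconj[OF y] z_def[symmetric]
      by (intro index_cut_partition_eq_iff) auto
    then show ?thesis
      using semiconj_less_a_iff semiconj_less_eta_iff[OF z01] by simp
  qed
  moreover have "z (t + j) = frac (z t + real j * \<rho>)" for t j
    by (simp add: z_def frac_add_frac_left algebra_simps)
  moreover have "map ?s [t..<t + n] = map ?s [t'..<t' + n] \<longleftrightarrow> (\<forall>j<n. ?s (t + j) = ?s (t' + j))" for t t'
    by (simp add: list_eq_iff_nth_eq)
  ultimately have "map ?s [t..<t + n] = map ?s [t'..<t' + n] \<longleftrightarrow>
      (\<forall>e\<in>rotation_cuts \<rho> \<alpha> n. z t < e \<longleftrightarrow> z t' < e)" for t t'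
    using rotation_word_eq_iff[OF \<rho> \<alpha> z01 z01, of n t t'] by simp
  also have "(\<forall>e\<in>E. z t < e \<longleftrightarrow> z t' < e) \<longleftrightarrow> {e \<in> E. e \<le> z t} = {e \<in> E. e \<le> z t'}" for E t t'
    by (auto simp: set_eq_iff not_le[symmetric])
  finally have "complexity ?s n = card (range (\<lambda>t. {e \<in> rotation_cuts \<rho> \<alpha> n. e \<le> z t}))"
    unfolding complexity_def by (rule card_range_eq_of_same_kernel)
  also have "\<dots> = card ((\<lambda>z. {e \<in> rotation_cuts \<rho> \<alpha> n. e \<le> z}) ` range z)"
    by (simp add: image_image)
  also have "\<dots> = card (rotation_cuts \<rho> \<alpha> n)"
  proof (rule card_cells_of_dense)
    show "finite (rotation_cuts \<rho> \<alpha> n)" "rotation_cuts \<rho> \<alpha> n \<subseteq> {0..<1}"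
      by (auto simp: rotation_cuts_def frac_lt_1)
    show "0 \<in> rotation_cuts \<rho> \<alpha> n"
      unfolding rotation_cuts_def by (rule UnI1, rule image_eqI[of _ _ 0]) auto
    show "range z \<subseteq> {0..<1}"
      using z01 by blast
    show "\<exists>x\<in>range z. u < x \<and> x < v" if "0 \<le> u" "u < v" "v \<le> 1" for u v
      using rotation_orbit_dense[OF that, of y] by (simp add: z_def)
  qed
  finally show ?thesis .
qed

end

theorem corollary2p13:
  fixes l d \<rho> \<alpha> \<delta> a :: real
  assumes "l \<in> {0<..<1}"
    and "d \<in> {0<..<1 - l}"
    and "\<rho> \<in> {0<..<1}" and "\<rho> \<notin> \<rat>"
    and "\<alpha> \<in> {0..1}"
    and "\<delta> \<in> {1 - l - d<..<1}"
    and "a \<in> {0..1}"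
    and "\<delta> \<in> {delta_par_left l d \<rho> \<alpha>..delta_par l d \<rho> \<alpha>}"
    and "a \<in> {a_par_right l d \<delta> \<rho> \<alpha>..a_par l d \<delta> \<rho> \<alpha>}"
  defines "f \<equiv> contraction l d \<delta> a"
    and "P \<equiv> cut_partition {a, eta l d \<delta> a \<rho> \<alpha>}"
  shows "length P \<in> {2, 3} \<and>
    P = cut_partition (discontinuities f) \<and>
    (\<forall>x \<in> attractor f.
       ((\<forall>k::int. frac \<alpha> \<noteq> rotation_power \<rho> k 0) \<longrightarrow>
          (\<forall>n\<ge>1. complexity (orbit_code f P x) n = 2 * n + 1)) \<and>
       (\<forall>k::int. frac \<alpha> = rotation_power \<rho> k 0 \<longrightarrow>
          (\<forall>n\<ge>max 1 (complexity_offset k - 1).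
             complexity (orbit_code f P x) n = n + complexity_offset k)))"
proof -
  interpret quasiperiodic_contraction l d \<rho> \<alpha> \<delta> a
    by unfold_locales (fact assms(1-9))+
  let ?C = "{a, eta l d \<delta> a \<rho> \<alpha>} \<inter> {0<..<1}"
  \<comment> \<open>\<eta> is always an inner cut, which gives at least two intervals;
    \<open>a\<close> adds at most one.\<close>
  have "{eta l d \<delta> a \<rho> \<alpha>} \<subseteq> ?C"
    using eta_unit by simp
  then have "1 \<le> card ?C"
    using card_mono[of ?C "{eta l d \<delta> a \<rho> \<alpha>}"] by simp
  moreover have "card ?C \<le> 2"
    using card_mono[of "{a, eta l d \<delta> a \<rho> \<alpha>}" ?C] card_insert_if[of "{eta l d \<delta> a \<rho> \<alpha>}" a]
    by (simp split: if_splits)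
  ultimately have "length P \<in> {2, 3}"
    by (auto simp: P_def length_cut_partition)
  moreover have "P = cut_partition (discontinuities f)"
    unfolding P_def f_def by (rule cut_partition_cong) (rule discontinuities_inner[symmetric])
  moreover have "complexity (orbit_code f P x) n = card (rotation_cuts \<rho> \<alpha> n)" if "x \<in> attractor f" for x n
    using that unfolding P_def f_def by (rule complexity_orbit_code)
  ultimately show ?thesis
    using card_rotation_cuts_generic[OF \<open>\<rho> \<notin> \<rat>\<close>] card_rotation_cuts_resonant[OF \<open>\<rho> \<notin> \<rat>\<close>]
    by (simp add: rotation_power_def)
qed

end
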